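(* Let $d\in\mathbb N$, $p>2$, let $\Omega\subset\mathbb R^d$ be an open set and $f\in C(\Omega)$. Let $m(\varepsilon)=\varepsilon^{\frac{2}{2+\alpha}}$ and $M(\varepsilon)=\varepsilon^{-\frac{2}{2-\alpha}}$ for $\varepsilon>0$, and let $\mathcal A_\varepsilon[\,\cdot\,;f]$ be either $\overline{\mathcal A}_\varepsilon[\,\cdot\,;f]$ or $\underline{\mathcal A}_\varepsilon[\,\cdot\,;f]$ (see context). Then $u$ is a viscosity solution to $$\Delta_pu(x)=f(x)\quad\text{for }x\in\Omega$$ if and only if $u$ is a viscosity solution to $$u(x)=\mathcal A_\varepsilon[u;f](x)-\varepsilon^2J_p(f(x))+o(\varepsilon^2)\quad\text{for }x\in\Omega,\ \text{as }\varepsilon\to0^+.$$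
   Context: Constants: $\alpha=\frac{p-2}{p-1}$, $\beta=\frac{p-2}{p+d}$, $\gamma=\sqrt{2(p+d)}$. $B_r(x)$ is the open ball of radius $r$ centred at $x$. The $p$-Laplacian is $\Delta_p\varphi=\nabla\cdot(|\nabla\varphi|^{p-2}\nabla\varphi)$ (for $C^2$ functions, equal to $0$ where $\nabla\varphi=0$, as $p>2$). The signed power is $J_p(\xi)=\xi^{\frac1{p-1}}$ for $\xi\ge0$ and $J_p(\xi)=-(-\xi)^{\frac1{p-1}}$ for $\xi\le 0$. Operators: for $r>0$, $$\mathcal M_r[\varphi](x)=\beta\Big(\tfrac12\sup_{B_{\gamma r}(x)}\varphi+\tfrac12\inf_{B_{\gamma r}(x)}\varphi\Big)+(1-\beta)\frac{1}{|B_{\gamma r}(x)|}\int_{B_{\gamma r}(x)}\varphi(y)\,dy ,$$ $$\mathcal A^+_\varepsilon[\varphi](x)=\inf_{c\in[m(\varepsilon),M(\varepsilon)]}\Big\{\alpha\sup_{B_{\varepsilon^2c^{1-\alpha}}(x)}\varphi+(1-\alpha)\mathcal M_{\varepsilon c^{-\alpha/2}}[\varphi](x)\Big\},$$ $$\mathcal A^-_\varepsilon[\varphi](x)=\sup_{c\in[m(\varepsilon),M(\varepsilon)]}\Big\{\alpha\inf_{B_{\varepsilon^2c^{1-\alpha}}(x)}\varphi+(1-\alpha)\mathcal M_{\varepsilon c^{-\alpha/2}}[\varphi](x)\Big\}.$$ $\overline{\mathcal A}_\varepsilon[\varphi;f](x)$ equals $\mathcal A^+_\varepsilon[\varphi](x)$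 if $f(x)\ge0$ and $\mathcal A^-_\varepsilon[\varphi](x)$ if $f(x)<0$; $\underline{\mathcal A}_\varepsilon[\varphi;f](x)$ equals $\mathcal A^+_\varepsilon[\varphi](x)$ if $f(x)>0$ and $\mathcal A^-_\varepsilon[\varphi](x)$ if $f(x)\le0$. Touching: for $x_0\in\Omega$, a function $\varphi$ on $B_R(x_0)$ touches $u$ from below (resp. above) at $x_0$ if $\varphi(x)-u(x)\le\varphi(x_0)-u(x_0)$ (resp. $\ge$) for all $x\in(B_R(x_0)\setminus\{x_0\})\cap\Omega$. Viscosity solutions of the PDE: a bounded lower (resp. upper) semicontinuous function $u$ in $\Omega$ is a viscosity supersolution (resp. subsolution) of $\Delta_pu=f$ in $\Omega$ if, whenever $x_0\in\Omega$ and $\varphi\in C^2(B_R(x_0))$ for some $R>0$ touches $u$ from below (resp. above) at $x_0$, with $\nabla\varphi(x_0)\ne0$ in case $f(x_0)=0$, one has $\Delta_p\varphi(x_0)\le f(x_0)$ (resp. $\ge$). A viscosity solution is a bounded continuous function that is both a viscosity super- and subsolution. Viscosity solutions of the asymptotic mean value property: a bounded lower (resp. upper) semicontinuous function $u$ in $\Omega$ is a viscosity supersolution (resp. subsolution) of $\mathcal A_\varepsilon[u;f]-u=\varepsilon^2J_p(f)+o(\varepsilon^2)$ in $\Omega$ if, whenever $x_0\in\Omega$ and $\varphi\in C^\infty(B_R(x_0))$ for some $R>0$ touches $u$ from below (resp. above) at $x_0$, with both $\nabla\varphi(x_0)\ne0$ and $\Delta_p\varphi(x_0)\ne0$ in case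 $f(x_0)=0$, one has $\mathcal A_\varepsilon[\varphi;f](x_0)-\varphi(x_0)\le\varepsilon^2J_p(f(x_0))+o(\varepsilon^2)$ (resp. $\ge$) as $\varepsilon\to0^+$. A viscosity solution is a continuous function that is both a viscosity super- and subsolution. Here $a_\varepsilon\le b_\varepsilon+o(\varepsilon^2)$ means $\limsup_{\varepsilon\to0^+}(a_\varepsilon-b_\varepsilon)/\varepsilon^2\le0$, and similarly for $\ge$ with $\liminf$. *)

theory Defs
  imports "HOL-Analysis.Analysis"
begin

section \<open>Differential operators and test functions\<close>

definition grad :: "('a::euclidean_space \<Rightarrow> real) \<Rightarrow> 'a \<Rightarrow> 'a" where
  "grad \<phi> x = (\<Sum>i\<in>Basis. frechet_derivative \<phi> (at x) i *\<^sub>R i)"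

definition divergence :: "('a::euclidean_space \<Rightarrow> 'a) \<Rightarrow> 'a \<Rightarrow> real" where
  "divergence F x = (\<Sum>i\<in>Basis. frechet_derivative F (at x) i \<bullet> i)"

text \<open>For \<open>p > 2\<close> and \<open>\<phi>\<close> of class \<open>C\<^sup>2\<close> near \<open>x\<close>, the field below is differentiable at \<open>x\<close> even
  if \<open>grad \<phi> x = 0\<close>: it is then \<open>O(\<bar>y - x\<bar> powr (p - 1))\<close>, so its divergence at \<open>x\<close> is \<open>0\<close>.\<close>

definition p_laplacian :: "real \<Rightarrow> ('a::euclidean_space \<Rightarrow> real) \<Rightarrow> 'a \<Rightarrow> real" where
  "p_laplacian p \<phi> x = divergence (\<lambda>y. (norm (grad \<phi> y) powr (p - 2)) *\<^sub>R grad \<phi> y) x"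

text \<open>The class \<open>C\<^sup>k\<close> on an open set \<open>S\<close>; the values of \<open>\<phi>\<close> outside \<open>S\<close> are irrelevant.\<close>

primrec Ck_on :: "nat \<Rightarrow> ('a::euclidean_space \<Rightarrow> real) \<Rightarrow> 'a set \<Rightarrow> bool" where
  "Ck_on 0 \<phi> S \<longleftrightarrow> continuous_on S \<phi>"
| "Ck_on (Suc k) \<phi> S \<longleftrightarrow> \<phi> differentiable_on S \<and>
     (\<forall>i\<in>Basis. Ck_on k (\<lambda>x. frechet_derivative \<phi> (at x) i) S)"

definition Cinf_on :: "('a::euclidean_space \<Rightarrow> real) \<Rightarrow> 'a set \<Rightarrow> bool" where
  "Cinf_on \<phi> S \<longleftrightarrow> (\<forall>k. Ck_on k \<phi> S)"

definition lower_semicontinuous_on :: "'a::topological_space set \<Rightarrow> ('a \<Rightarrow> real) \<Rightarrow> bool" where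
  "lower_semicontinuous_on S u \<longleftrightarrow> (\<forall>x\<in>S. \<forall>a. a < u x \<longrightarrow> (\<forall>\<^sub>F y in at x within S. a < u y))"

definition upper_semicontinuous_on :: "'a::topological_space set \<Rightarrow> ('a \<Rightarrow> real) \<Rightarrow> bool" where
  "upper_semicontinuous_on S u \<longleftrightarrow> (\<forall>x\<in>S. \<forall>a. u x < a \<longrightarrow> (\<forall>\<^sub>F y in at x within S. u y < a))"

definition touches_from_below ::
  "'a::euclidean_space set \<Rightarrow> real \<Rightarrow> ('a \<Rightarrow> real) \<Rightarrow> ('a \<Rightarrow> real) \<Rightarrow> 'a \<Rightarrow> bool" where
  "touches_from_below \<Omega> R \<phi> u x0 \<longleftrightarrow>
     (\<forall>x \<in> (ball x0 R - {x0}) \<inter> \<Omega>. \<phi> x - u x \<le> \<phi> x0 - u x0)"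

definition touches_from_above ::
  "'a::euclidean_space set \<Rightarrow> real \<Rightarrow> ('a \<Rightarrow> real) \<Rightarrow> ('a \<Rightarrow> real) \<Rightarrow> 'a \<Rightarrow> bool" where
  "touches_from_above \<Omega> R \<phi> u x0 \<longleftrightarrow>
     (\<forall>x \<in> (ball x0 R - {x0}) \<inter> \<Omega>. \<phi> x - u x \<ge> \<phi> x0 - u x0)"


section \<open>Constants and mean value operators\<close>

definition alpha_const :: "real \<Rightarrow> real" where
  "alpha_const p = (p - 2) / (p - 1)"

definition beta_const :: "real \<Rightarrow> nat \<Rightarrow> real" where
  "beta_const p d = (p - 2) / (p + real d)"

definition gamma_const :: "real \<Rightarrow> nat \<Rightarrow> real" where
  "gamma_const p d = sqrt (2 * (p + real d))"

definition signed_power :: "real \<Rightarrow> real \<Rightarrow> real" where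
  "signed_power p \<xi> =
     (if \<xi> \<ge> 0 then \<xi> powr (1 / (p - 1)) else - ((- \<xi>) powr (1 / (p - 1))))"

text \<open>The suprema and infima below are taken in \<open>real\<close>. They carry their usual meaning only where
  the sets are nonempty and bounded; for \<open>\<phi>\<close> continuous on a ball around \<open>x\<close> and the bounds
  \<open>m\<close>, \<open>M\<close> of the theorem this is the case for all sufficiently small \<open>\<epsilon> > 0\<close>, which is
  all that matters in the limit \<open>\<epsilon> \<rightarrow> 0\<close>.\<close>

definition mean_op :: "real \<Rightarrow> real \<Rightarrow> ('a::euclidean_space \<Rightarrow> real) \<Rightarrow> 'a \<Rightarrow> real" where
  "mean_op p r \<phi> x =
     (let \<beta> = beta_const p DIM('a); B = ball x (gamma_const p DIM('a) * r)
      in \<beta> * ((1/2) * (SUP y\<in>B. \<phi> y) + (1/2) * (INF y\<in>B. \<phi> y))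
         + (1 - \<beta>) * (1 / measure lborel B) * (LINT y:B|lborel. \<phi> y))"

definition A_plus ::
  "real \<Rightarrow> (real \<Rightarrow> real) \<Rightarrow> (real \<Rightarrow> real) \<Rightarrow> real \<Rightarrow> ('a::euclidean_space \<Rightarrow> real) \<Rightarrow> 'a \<Rightarrow> real" where
  "A_plus p m M \<epsilon> \<phi> x =
     (let \<alpha> = alpha_const p
      in INF c\<in>{m \<epsilon>..M \<epsilon>}.
           \<alpha> * (SUP y\<in>ball x (\<epsilon>^2 * c powr (1 - \<alpha>)). \<phi> y)
           + (1 - \<alpha>) * mean_op p (\<epsilon> * c powr (- \<alpha> / 2)) \<phi> x)"

definition A_minus ::
  "real \<Rightarrow> (real \<Rightarrow> real) \<Rightarrow> (real \<Rightarrow> real) \<Rightarrow> real \<Rightarrow> ('a::euclidean_space \<Rightarrow> real) \<Rightarrow> 'a \<Rightarrow> real" where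
  "A_minus p m M \<epsilon> \<phi> x =
     (let \<alpha> = alpha_const p
      in SUP c\<in>{m \<epsilon>..M \<epsilon>}.
           \<alpha> * (INF y\<in>ball x (\<epsilon>^2 * c powr (1 - \<alpha>)). \<phi> y)
           + (1 - \<alpha>) * mean_op p (\<epsilon> * c powr (- \<alpha> / 2)) \<phi> x)"

text \<open>The two operators differ only where \<open>f x = 0\<close>.\<close>

definition A_over ::
  "real \<Rightarrow> (real \<Rightarrow> real) \<Rightarrow> (real \<Rightarrow> real) \<Rightarrow> real \<Rightarrow>
    ('a::euclidean_space \<Rightarrow> real) \<Rightarrow> ('a \<Rightarrow> real) \<Rightarrow> 'a \<Rightarrow> real" where
  "A_over p m M \<epsilon> \<phi> f x = (if f x \<ge> 0 then A_plus p m M \<epsilon> \<phi> x else A_minus p m M \<epsilon> \<phi> x)"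

definition A_under ::
  "real \<Rightarrow> (real \<Rightarrow> real) \<Rightarrow> (real \<Rightarrow> real) \<Rightarrow> real \<Rightarrow>
    ('a::euclidean_space \<Rightarrow> real) \<Rightarrow> ('a \<Rightarrow> real) \<Rightarrow> 'a \<Rightarrow> real" where
  "A_under p m M \<epsilon> \<phi> f x = (if f x > 0 then A_plus p m M \<epsilon> \<phi> x else A_minus p m M \<epsilon> \<phi> x)"


section \<open>Viscosity solutions of the p-Poisson equation\<close>

definition pde_supersolution ::
  "real \<Rightarrow> 'a::euclidean_space set \<Rightarrow> ('a \<Rightarrow> real) \<Rightarrow> ('a \<Rightarrow> real) \<Rightarrow> bool" where
  "pde_supersolution p \<Omega> f u \<longleftrightarrow>
     bounded (u ` \<Omega>) \<and> lower_semicontinuous_on \<Omega> u \<and>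
     (\<forall>x0\<in>\<Omega>. \<forall>R>0. \<forall>\<phi>.
        Ck_on 2 \<phi> (ball x0 R) \<and> touches_from_below \<Omega> R \<phi> u x0 \<and>
        (f x0 = 0 \<longrightarrow> grad \<phi> x0 \<noteq> 0) \<longrightarrow>
        p_laplacian p \<phi> x0 \<le> f x0)"

definition pde_subsolution ::
  "real \<Rightarrow> 'a::euclidean_space set \<Rightarrow> ('a \<Rightarrow> real) \<Rightarrow> ('a \<Rightarrow> real) \<Rightarrow> bool" where
  "pde_subsolution p \<Omega> f u \<longleftrightarrow>
     bounded (u ` \<Omega>) \<and> upper_semicontinuous_on \<Omega> u \<and>
     (\<forall>x0\<in>\<Omega>. \<forall>R>0. \<forall>\<phi>.
        Ck_on 2 \<phi> (ball x0 R) \<and> touches_from_above \<Omega> R \<phi> u x0 \<and>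
        (f x0 = 0 \<longrightarrow> grad \<phi> x0 \<noteq> 0) \<longrightarrow>
        p_laplacian p \<phi> x0 \<ge> f x0)"

definition pde_solution ::
  "real \<Rightarrow> 'a::euclidean_space set \<Rightarrow> ('a \<Rightarrow> real) \<Rightarrow> ('a \<Rightarrow> real) \<Rightarrow> bool" where
  "pde_solution p \<Omega> f u \<longleftrightarrow>
     bounded (u ` \<Omega>) \<and> continuous_on \<Omega> u \<and>
     pde_supersolution p \<Omega> f u \<and> pde_subsolution p \<Omega> f u"


section \<open>Viscosity solutions of the asymptotic mean value property\<close>

text \<open>One-sided inequalities up to \<open>o(\<epsilon>\<^sup>2)\<close> as \<open>\<epsilon> \<rightarrow> 0\<^sup>+\<close>.\<close>

definition le_o_sq :: "(real \<Rightarrow> real) \<Rightarrow> (real \<Rightarrow> real) \<Rightarrow> bool" where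
  "le_o_sq a b \<longleftrightarrow> Limsup (at_right 0) (\<lambda>\<epsilon>. ereal ((a \<epsilon> - b \<epsilon>) / \<epsilon>^2)) \<le> 0"

definition ge_o_sq :: "(real \<Rightarrow> real) \<Rightarrow> (real \<Rightarrow> real) \<Rightarrow> bool" where
  "ge_o_sq a b \<longleftrightarrow> Liminf (at_right 0) (\<lambda>\<epsilon>. ereal ((a \<epsilon> - b \<epsilon>) / \<epsilon>^2)) \<ge> 0"

text \<open>The argument \<open>A\<close> is the family \<open>\<epsilon> \<mapsto> A\<^sub>\<epsilon>[\<phi>; f](x)\<close>, to be instantiated with
  \<^term>\<open>A_over p m M\<close> or \<^term>\<open>A_under p m M\<close>.\<close>

definition amvp_supersolution ::
  "real \<Rightarrow> (real \<Rightarrow> ('a::euclidean_space \<Rightarrow> real) \<Rightarrow> ('a \<Rightarrow> real) \<Rightarrow> 'a \<Rightarrow> real) \<Rightarrow>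
    'a set \<Rightarrow> ('a \<Rightarrow> real) \<Rightarrow> ('a \<Rightarrow> real) \<Rightarrow> bool" where
  "amvp_supersolution p A \<Omega> f u \<longleftrightarrow>
     bounded (u ` \<Omega>) \<and> lower_semicontinuous_on \<Omega> u \<and>
     (\<forall>x0\<in>\<Omega>. \<forall>R>0. \<forall>\<phi>.
        Cinf_on \<phi> (ball x0 R) \<and> touches_from_below \<Omega> R \<phi> u x0 \<and>
        (f x0 = 0 \<longrightarrow> grad \<phi> x0 \<noteq> 0 \<and> p_laplacian p \<phi> x0 \<noteq> 0) \<longrightarrow>
        le_o_sq (\<lambda>\<epsilon>. A \<epsilon> \<phi> f x0 - \<phi> x0) (\<lambda>\<epsilon>. \<epsilon>^2 * signed_power p (f x0)))"

definition amvp_subsolution ::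
  "real \<Rightarrow> (real \<Rightarrow> ('a::euclidean_space \<Rightarrow> real) \<Rightarrow> ('a \<Rightarrow> real) \<Rightarrow> 'a \<Rightarrow> real) \<Rightarrow>
    'a set \<Rightarrow> ('a \<Rightarrow> real) \<Rightarrow> ('a \<Rightarrow> real) \<Rightarrow> bool" where
  "amvp_subsolution p A \<Omega> f u \<longleftrightarrow>
     bounded (u ` \<Omega>) \<and> upper_semicontinuous_on \<Omega> u \<and>
     (\<forall>x0\<in>\<Omega>. \<forall>R>0. \<forall>\<phi>.
        Cinf_on \<phi> (ball x0 R) \<and> touches_from_above \<Omega> R \<phi> u x0 \<and>
        (f x0 = 0 \<longrightarrow> grad \<phi> x0 \<noteq> 0 \<and> p_laplacian p \<phi> x0 \<noteq> 0) \<longrightarrow>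
        ge_o_sq (\<lambda>\<epsilon>. A \<epsilon> \<phi> f x0 - \<phi> x0) (\<lambda>\<epsilon>. \<epsilon>^2 * signed_power p (f x0)))"

definition amvp_solution ::
  "real \<Rightarrow> (real \<Rightarrow> ('a::euclidean_space \<Rightarrow> real) \<Rightarrow> ('a \<Rightarrow> real) \<Rightarrow> 'a \<Rightarrow> real) \<Rightarrow>
    'a set \<Rightarrow> ('a \<Rightarrow> real) \<Rightarrow> ('a \<Rightarrow> real) \<Rightarrow> bool" where
  "amvp_solution p A \<Omega> f u \<longleftrightarrow>
     continuous_on \<Omega> u \<and> amvp_supersolution p A \<Omega> f u \<and> amvp_subsolution p A \<Omega> f u"

end

theory Submission
  imports Defs
begin

text \<open>Both notions of solution test \<open>u\<close> with functions touching it at a single point, so the theorem is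
a statement about one test function at one point. It rests on two facts.

\<^emph>\<open>Consistency.\<close> Let \<open>\<phi>\<close> be of class \<open>C\<^sup>2\<close> near \<open>x\<close>, with gradient \<open>q \<noteq> 0\<close> and Hessian \<open>X\<close>, and put
\<open>L = tr X + (p - 2) \<langle>X q, q\<rangle> / \<bar>q\<bar>\<^sup>2\<close>, so that the p-Laplacian of \<open>\<phi>\<close> at \<open>x\<close> is
\<open>\<Delta> = \<bar>q\<bar> powr (p - 2) * L\<close>. The midrange of \<open>\<phi>\<close> over a small ball sees \<open>\<langle>X q, q\<rangle> / \<bar>q\<bar>\<^sup>2\<close>, the average
sees \<open>tr X\<close>, and \<open>\<beta>\<close>, \<open>\<gamma>\<close> are the constants for which the mean operator of radius \<open>r\<close> is
\<open>\<phi>(x) + L r\<^sup>2 + o(r\<^sup>2)\<close>. The supremum over a ball of radius \<open>\<rho>\<close> is \<open>\<phi>(x) + \<bar>q\<bar> \<rho> + o(\<rho>)\<close>. Hence, at scale \<open>c\<close>,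
the expression minimised in \<open>A_plus\<close> is \<open>\<phi>(x)\<close> plus \<open>\<epsilon>\<^sup>2\<close> times
\<open>\<alpha> c powr (1 - \<alpha>) \<bar>q\<bar> + (1 - \<alpha>) c powr (- \<alpha>) L\<close>. If \<open>L > 0\<close>, Young's inequality bounds this below by
\<open>\<bar>q\<bar> powr \<alpha> * L powr (1 - \<alpha>)\<close>, which is exactly the signed power of \<open>\<Delta>\<close>, and \<open>c = L / \<bar>q\<bar>\<close> attains the bound.
If \<open>L \<le> 0\<close>, letting \<open>c \<rightarrow> 0\<close> pushes the infimum down to \<open>0\<close> (to \<open>-\<infinity>\<close> if \<open>L < 0\<close>); if \<open>q = 0\<close>, letting
\<open>c \<rightarrow> \<infinity>\<close> does. Upper bounds need one fixed \<open>c\<close> at a time. The lower bound must be uniform over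
the whole range of \<open>c\<close>; it is, because the two ends of the range are such that all radii tend
to \<open>0\<close> together with \<open>\<epsilon>\<close>. This gives \<open>A_plus_consistent\<close>: when \<open>f(x) \<ge> 0\<close> (and \<open>\<Delta> \<noteq> 0\<close> if \<open>f(x) = 0\<close>),
the asymptotic inequality with right-hand side \<open>\<epsilon>\<^sup>2\<close> times the signed power of \<open>f(x)\<close> is equivalent
to the corresponding inequality between \<open>\<Delta>\<close> and \<open>f(x)\<close>. The case \<open>f(x) \<le> 0\<close> follows by replacing
\<open>\<phi>\<close> with \<open>- \<phi>\<close>.

\<^emph>\<open>Smooth tests suffice.\<close> The differential equation is tested with \<open>C\<^sup>2\<close> functions, the mean value
property with smooth ones, and at zeros of \<open>f\<close> only with those having \<open>\<Delta> \<noteq> 0\<close>. If a \<open>C\<^sup>2\<close> test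
violates the differential inequality, then its second-order Taylor polynomial, tilted slightly
by a multiple of \<open>\<bar>y - x\<bar>\<^sup>2\<close>, is smooth, still touches \<open>u\<close> at the same point with the same gradient,
and still violates the inequality strictly; at a zero of \<open>f\<close> that forces \<open>\<Delta> \<noteq> 0\<close>.\<close>

section \<open>Second moments of balls\<close>

text \<open>The change of variables for \<open>x \<mapsto> x + (t - 1) (x \<bullet> i) i\<close>, which multiplies the coordinate along
\<open>i\<close> by \<open>t\<close>. For \<open>t = -1\<close> it is a reflection and yields the symmetries of the ball; for \<open>t\<close> near \<open>1\<close> it
yields its second moments.\<close>

lemma
  fixes f :: "'a::euclidean_space \<Rightarrow> real"
  assumes i: "i \<in> Basis" and t: "t \<noteq> 0" and f[measurable]: "f \<in> borel_measurable borel"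
  shows lborel_integral_stretch:
      "(\<integral>x. f x \<partial>lborel) = \<bar>t\<bar> * (\<integral>x. f (x + ((t - 1) * (x \<bullet> i)) *\<^sub>R i) \<partial>lborel)"
    and lborel_integrable_stretch:
      "integrable lborel f \<longleftrightarrow> integrable lborel (\<lambda>x. f (x + ((t - 1) * (x \<bullet> i)) *\<^sub>R i))"
proof -
  define c where "c j = (if j = i then t else 1)" for j :: 'a
  have cn: "c j \<noteq> 0" if "j \<in> Basis" for j
    using t by (auto simp: c_def)
  have T: "0 + (\<Sum>j\<in>Basis. (c j * (x \<bullet> j)) *\<^sub>R j) = x + ((t - 1) * (x \<bullet> i)) *\<^sub>R i" for x :: 'a
  proof -
    have "(\<Sum>j\<in>Basis. (c j * (x \<bullet> j)) *\<^sub>R j)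
        = (\<Sum>j\<in>Basis. (x \<bullet> j) *\<^sub>R j + (if i = j then ((t - 1) * (x \<bullet> j)) *\<^sub>R j else 0))"
      by (intro sum.cong) (auto simp: c_def algebra_simps)
    also have "\<dots> = x + ((t - 1) * (x \<bullet> i)) *\<^sub>R i"
      using i by (simp only: sum.distrib euclidean_representation sum.delta sum.delta' finite_Basis if_True)
    finally show ?thesis by simp
  qed
  have P: "(\<Prod>j\<in>Basis. \<bar>c j\<bar>) = \<bar>t\<bar>"
  proof -
    have "(\<Prod>j\<in>Basis. \<bar>c j\<bar>) = (\<Prod>j\<in>Basis. if i = j then \<bar>t\<bar> else 1)"
      by (intro prod.cong) (auto simp: c_def)
    also have "\<dots> = \<bar>t\<bar>" using i by (simp add: prod.delta)
    finally show ?thesis .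
  qed
  have L: "(lborel :: 'a measure) =
      density (distr lborel borel (\<lambda>x. x + ((t - 1) * (x \<bullet> i)) *\<^sub>R i)) (\<lambda>_. ennreal \<bar>t\<bar>)"
    using lborel_affine_euclidean[of c 0, OF cn] unfolding T P by simp
  have [measurable]: "(\<lambda>x. x + ((t - 1) * (x \<bullet> i)) *\<^sub>R i) \<in> borel \<rightarrow>\<^sub>M borel"
    by measurable
  show "(\<integral>x. f x \<partial>lborel) = \<bar>t\<bar> * (\<integral>x. f (x + ((t - 1) * (x \<bullet> i)) *\<^sub>R i) \<partial>lborel)"
    by (subst L) (simp add: integral_density integral_distr)
  show "integrable lborel f \<longleftrightarrow> integrable lborel (\<lambda>x. f (x + ((t - 1) * (x \<bullet> i)) *\<^sub>R i))"
    using t by (subst L) (simp add: integrable_density integrable_distr_eq)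
qed

lemma set_integrable_ball:
  fixes g :: "'a::euclidean_space \<Rightarrow> real"
  assumes "continuous_on (cball x \<rho>) g"
  shows "set_integrable lborel (ball x \<rho>) g"
proof -
  have "set_integrable lborel (cball x \<rho>) g"
    unfolding set_integrable_def using borel_integrable_compact[OF compact_cball assms] by simp
  then show ?thesis
    by (rule set_integrable_subset) auto
qed

lemma set_integral_translate_ball:
  fixes g :: "'a::euclidean_space \<Rightarrow> real"
  assumes "set_integrable lborel (ball x \<rho>) g"
  shows "(LINT y:ball x \<rho>|lborel. g y) = (LINT h:ball 0 \<rho>|lborel. g (x + h))"
proof -
  have m[measurable]: "(\<lambda>y. indicator (ball x \<rho>) y *\<^sub>R g y) \<in> borel_measurable borel"
    using borel_measurable_integrable[OF assms[unfolded set_integrable_def]]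
    by (simp only: measurable_lborel2)
  have "(\<integral>y. indicator (ball x \<rho>) y *\<^sub>R g y \<partial>lborel)
     = (\<integral>y. indicator (ball x \<rho>) y *\<^sub>R g y \<partial>distr lborel borel ((+) x))"
    by (simp add: lborel_distr_plus)
  also have "\<dots> = (\<integral>h. indicator (ball x \<rho>) (x + h) *\<^sub>R g (x + h) \<partial>lborel)"
    by (rule integral_distr[OF _ m]) auto
  also have "\<dots> = (\<integral>h. indicator (ball 0 \<rho>) h *\<^sub>R g (x + h) \<partial>lborel)"
    by (intro Bochner_Integration.integral_cong) (auto simp: indicator_def dist_norm)
  finally show ?thesis by (simp add: set_lebesgue_integral_def)
qed

lemma norm_stretch_sq:
  fixes x i :: "'a::euclidean_space"
  assumes "i \<in> Basis"
  shows "(norm (x + ((t - 1) * (x \<bullet> i)) *\<^sub>R i))\<^sup>2 = (norm x)\<^sup>2 + (t\<^sup>2 - 1) * (x \<bullet> i)\<^sup>2"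
  using assms
  by (simp only: power2_norm_eq_inner)
     (simp add: inner_add_left inner_add_right inner_commute power2_eq_square algebra_simps)

lemma norm_reflect:
  fixes x i :: "'a::euclidean_space"
  assumes "i \<in> Basis"
  shows "norm (x + ((- 1 - 1) * (x \<bullet> i)) *\<^sub>R i) = norm x"
  using norm_stretch_sq[OF assms, of x "-1"] by (simp add: power2_eq_iff_nonneg)

lemma set_integral_ball_odd:
  fixes g :: "'a::euclidean_space \<Rightarrow> real"
  assumes i: "i \<in> Basis" and g: "g \<in> borel_measurable borel"
    and odd: "\<And>x. g (x + ((- 1 - 1) * (x \<bullet> i)) *\<^sub>R i) = - g x"
  shows "(LINT h:ball 0 \<rho>|lborel. g h) = 0"
proof -
  have "(LINT h:ball 0 \<rho>|lborel. g h)
      = \<bar>- 1\<bar> * (\<integral>x. indicator (ball 0 \<rho>) (x + ((- 1 - 1) * (x \<bullet> i)) *\<^sub>R i) *\<^sub>R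
           g (x + ((- 1 - 1) * (x \<bullet> i)) *\<^sub>R i) \<partial>lborel)"
    unfolding set_lebesgue_integral_def
    by (rule lborel_integral_stretch[OF i]) (auto intro!: borel_measurable_times borel_measurable_indicator g)
  also have "\<dots> = (\<integral>x. - (indicator (ball 0 \<rho>) x *\<^sub>R g x) \<partial>lborel)"
    unfolding odd using norm_reflect[OF i]
    by (auto intro!: Bochner_Integration.integral_cong simp: indicator_def)
  also have "\<dots> = - (LINT h:ball 0 \<rho>|lborel. g h)"
    by (simp add: set_lebesgue_integral_def)
  finally show ?thesis by simp
qed

text \<open>Stretching the paraboloid \<open>w = max 0 (\<rho>\<^sup>2 - \<bar>h\<bar>\<^sup>2)\<close> by a factor \<open>t\<close> along \<open>i\<close> divides its integral by
\<open>t\<close>, and to first order in \<open>t - 1\<close> it lowers the integrand by \<open>2 (t - 1) (h \<bullet> i)\<^sup>2\<close> on the ball.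
Comparing the two derivatives at \<open>t = 1\<close> relates the second moment to the integral of \<open>w\<close>.\<close>

lemma ball_second_moment_parabola:
  fixes i :: "'a::euclidean_space"
  assumes i: "i \<in> Basis" and \<rho>: "\<rho> > 0"
  shows "2 * (LINT h:ball 0 \<rho>|lborel. (h \<bullet> i)\<^sup>2) = (LINT h:ball (0::'a) \<rho>|lborel. \<rho>\<^sup>2 - (norm h)\<^sup>2)"
proof -
  define w where "w h = max 0 (\<rho>\<^sup>2 - (norm h)\<^sup>2)" for h :: 'a
  have in_ball: "h \<in> ball 0 \<rho> \<longleftrightarrow> (norm h)\<^sup>2 < \<rho>\<^sup>2" for h :: 'a
    unfolding mem_ball_0
    using power_mono_iff[of \<rho> "norm h" 2] \<rho> by (metis less_imp_le norm_ge_zero not_le zero_less_numeral)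
  have w_eq: "w h = indicator (ball 0 \<rho>) h *\<^sub>R (\<rho>\<^sup>2 - (norm h)\<^sup>2)" for h
    using in_ball[of h] by (auto simp: w_def indicator_def)
  define W where "W = (\<integral>h. w h \<partial>lborel)"
  define a where "a = (LINT h:ball 0 \<rho>|lborel. (h \<bullet> i)\<^sup>2)"
  have cont: "continuous_on (cball 0 \<rho>) (\<lambda>h::'a. \<rho>\<^sup>2 - (norm h)\<^sup>2)"
    by (intro continuous_intros)
  have int_w: "integrable lborel w"
    unfolding w_eq[abs_def] using set_integrable_ball[OF cont] by (simp only: set_integrable_def)
  then have [measurable]: "w \<in> borel_measurable borel"
    by (auto dest: borel_measurable_integrable)
  have cont2: "continuous_on (cball 0 \<rho>) (\<lambda>h::'a. (h \<bullet> i)\<^sup>2)"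
    by (intro continuous_intros)
  have int_a: "integrable lborel (\<lambda>h::'a. indicator (ball 0 \<rho>) h *\<^sub>R (h \<bullet> i)\<^sup>2)"
    using set_integrable_ball[OF cont2] by (simp only: set_integrable_def)
  \<comment> \<open>Holds on both sides of \<open>t = 1\<close>, since a maximum with \<open>0\<close> lies above its second argument;
    dividing by \<open>t - 1\<close> of either sign gives the two inequalities below.\<close>
  have key: "W - (t\<^sup>2 - 1) * a \<le> W / t" if "t > 0" for t
  proof -
    have "W - (t\<^sup>2 - 1) * a = (\<integral>h. w h - (t\<^sup>2 - 1) * (indicator (ball 0 \<rho>) h *\<^sub>R (h \<bullet> i)\<^sup>2) \<partial>lborel)"
      using int_w int_a by (simp add: W_def a_def set_lebesgue_integral_def)
    also have "\<dots> \<le> (\<integral>h. w (h + ((t - 1) * (h \<bullet> i)) *\<^sub>R i) \<partial>lborel)"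
    proof (rule integral_mono)
      show "integrable lborel (\<lambda>h. w (h + ((t - 1) * (h \<bullet> i)) *\<^sub>R i))"
        using lborel_integrable_stretch[OF i, of t w] int_w that by simp
      fix h :: 'a
      show "w h - (t\<^sup>2 - 1) * (indicator (ball 0 \<rho>) h *\<^sub>R (h \<bullet> i)\<^sup>2)
          \<le> w (h + ((t - 1) * (h \<bullet> i)) *\<^sub>R i)"
        using in_ball[of h] norm_stretch_sq[OF i, of h t] by (auto simp: w_def indicator_def)
    qed (use int_w int_a in auto)
    also have "\<dots> = W / t"
      using lborel_integral_stretch[OF i, of t w] that by (simp add: W_def)
    finally show ?thesis .
  qed
  have "((\<lambda>t. t * (t + 1) * a) \<longlongrightarrow> 1 * (1 + 1) * a) (at 1)"
    by (intro tendsto_intros)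
  then have L: "((\<lambda>t. t * (t + 1) * a) \<longlongrightarrow> 2 * a) (at 1)" by simp
  have "W \<le> 2 * a"
  proof (rule tendsto_lowerbound)
    show "((\<lambda>t. t * (t + 1) * a) \<longlongrightarrow> 2 * a) (at_right 1)"
      using L by (rule filterlim_mono) (auto simp: at_le)
    show "\<forall>\<^sub>F t in at_right 1. W \<le> t * (t + 1) * a"
      unfolding eventually_at_right_field
    proof (intro exI[of _ 2] conjI allI impI)
      fix t :: real assume t: "1 < t" "t < 2"
      have "(t - 1) * W \<le> (t - 1) * (t * (t + 1) * a)"
        using key[of t] t by (simp add: field_simps power2_eq_square)
      then show "W \<le> t * (t + 1) * a" using t by simp
    qed simp
  qed simp
  moreover have "2 * a \<le> W"
  proof (rule tendsto_upperbound)
    show "((\<lambda>t. t * (t + 1) * a) \<longlongrightarrow> 2 * a) (at_left 1)"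
      using L by (rule filterlim_mono) (auto simp: at_le)
    show "\<forall>\<^sub>F t in at_left 1. t * (t + 1) * a \<le> W"
      unfolding eventually_at_left_field
    proof (intro exI[of _ 0] conjI allI impI)
      fix t :: real assume t: "0 < t" "t < 1"
      have "(1 - t) * (t * (t + 1) * a) \<le> (1 - t) * W"
        using key[of t] t by (simp add: field_simps power2_eq_square)
      then show "t * (t + 1) * a \<le> W" using t by simp
    qed simp
  qed simp
  ultimately have "2 * a = W" by simp
  then show ?thesis
    by (simp only: W_def a_def w_eq set_lebesgue_integral_def)
qed

text \<open>Since the integral of \<open>\<rho>\<^sup>2 - \<bar>h\<bar>\<^sup>2\<close> does not depend on the coordinate \<open>i\<close>, all second moments are
equal; as they sum to the integral of \<open>\<bar>h\<bar>\<^sup>2\<close>, the preceding identity determines them.\<close>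

lemma ball_second_moment:
  fixes i :: "'a::euclidean_space"
  assumes i: "i \<in> Basis" and \<rho>: "\<rho> > 0"
  shows "(LINT h:ball 0 \<rho>|lborel. (h \<bullet> i)\<^sup>2)
      = \<rho>\<^sup>2 * measure lborel (ball (0::'a) \<rho>) / (real DIM('a) + 2)"
proof -
  define V where "V = measure lborel (ball (0::'a) \<rho>)"
  define a where "a j = (LINT h:ball 0 \<rho>|lborel. (h \<bullet> j)\<^sup>2)" for j :: 'a
  have int: "set_integrable lborel (ball 0 \<rho>) (\<lambda>h::'a. (h \<bullet> j)\<^sup>2)" for j
    by (intro set_integrable_ball continuous_intros)
  have int1: "set_integrable lborel (ball 0 \<rho>) (\<lambda>h::'a. \<rho>\<^sup>2)"
    by (intro set_integrable_ball continuous_intros)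
  have nrm: "(norm h)\<^sup>2 = (\<Sum>j\<in>Basis. (h \<bullet> j)\<^sup>2)" for h :: 'a
    by (simp only: power2_norm_eq_inner euclidean_inner[of h h]) (simp add: power2_eq_square)
  have "(LINT h:ball (0::'a) \<rho>|lborel. \<rho>\<^sup>2 - (norm h)\<^sup>2)
      = (LINT h:ball (0::'a) \<rho>|lborel. \<rho>\<^sup>2) - (LINT h:ball (0::'a) \<rho>|lborel. (\<Sum>j\<in>Basis. (h \<bullet> j :: real)\<^sup>2))"
    unfolding nrm[symmetric] by (intro set_integral_diff int1 set_integrable_ball continuous_intros)
  also have "(LINT h:ball (0::'a) \<rho>|lborel. \<rho>\<^sup>2) = \<rho>\<^sup>2 * V"
    by (simp add: set_lebesgue_integral_def V_def)
  also have "(LINT h:ball (0::'a) \<rho>|lborel. (\<Sum>j\<in>Basis. (h \<bullet> j)\<^sup>2)) = (\<Sum>j\<in>Basis. a j)"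
    unfolding set_lebesgue_integral_def a_def scaleR_sum_right
    by (rule Bochner_Integration.integral_sum) (rule int[unfolded set_integrable_def])
  finally have *: "2 * a j = \<rho>\<^sup>2 * V - (\<Sum>j\<in>Basis. a j)" if "j \<in> Basis" for j
    using ball_second_moment_parabola[OF that \<rho>] by (simp add: a_def)
  have "a j = a i" if "j \<in> Basis" for j
    using *[OF that] *[OF i] by simp
  then have "(\<Sum>j\<in>Basis. a j) = real DIM('a) * a i" by simp
  with *[OF i] have "a i * (real DIM('a) + 2) = \<rho>\<^sup>2 * V" by (simp add: algebra_simps)
  then have "a i = \<rho>\<^sup>2 * V / (real DIM('a) + 2)"
    by (simp add: field_simps add_eq_0_iff)
  then show ?thesis by (simp add: a_def V_def)
qed

text \<open>Linear terms and mixed second moments vanish by reflection, so that only the trace survives.\<close>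

lemma set_integral_ball_quadratic:
  fixes X :: "'a::euclidean_space \<Rightarrow> 'a"
  assumes X: "linear X" and \<rho>: "\<rho> > 0"
  shows "(LINT h:ball 0 \<rho>|lborel. k + q \<bullet> h + (1/2) * (X h \<bullet> h))
      = measure lborel (ball (0::'a) \<rho>) *
          (k + \<rho>\<^sup>2 / (2 * (real DIM('a) + 2)) * (\<Sum>i\<in>Basis. X i \<bullet> i))"
proof -
  define V where "V = measure lborel (ball (0::'a) \<rho>)"
  define c where "c = \<rho>\<^sup>2 * V / (real DIM('a) + 2)"
  have int: "set_integrable lborel (ball (0::'a) \<rho>) g" if "continuous_on UNIV g" for g :: "'a \<Rightarrow> real"
    by (rule set_integrable_ball) (rule continuous_on_subset[OF that], simp)
  have lin: "(LINT h:ball 0 \<rho>|lborel. h \<bullet> i) = 0" if "i \<in> Basis" for i :: 'a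
    using that by (intro set_integral_ball_odd[of i]) (auto simp: inner_diff_left)
  have quad: "(LINT h:ball 0 \<rho>|lborel. (h \<bullet> i) * (h \<bullet> j)) = (if i = j then c else 0)"
    if "i \<in> Basis" "j \<in> Basis" for i j :: 'a
  proof (cases "i = j")
    case True
    then show ?thesis using ball_second_moment[OF that(1) \<rho>] by (simp add: c_def V_def power2_eq_square)
  next
    case False
    then show ?thesis using that
      by (auto intro!: set_integral_ball_odd[of i] simp: inner_diff_left inner_Basis)
  qed
  have Xe: "X h \<bullet> h = (\<Sum>i\<in>Basis. \<Sum>j\<in>Basis. (X i \<bullet> j) * ((h \<bullet> i) * (h \<bullet> j)))" for h
  proof -
    have "X h = (\<Sum>i\<in>Basis. (h \<bullet> i) *\<^sub>R X i)"
      by (subst euclidean_representation[symmetric, of h])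
         (simp add: linear_sum[OF X] linear_scale[OF X])
    then have "X h \<bullet> h = (\<Sum>i\<in>Basis. (h \<bullet> i) * (X i \<bullet> h))"
      by (simp add: inner_sum_left)
    also have "\<dots> = (\<Sum>i\<in>Basis. (h \<bullet> i) * (\<Sum>j\<in>Basis. (X i \<bullet> j) * (h \<bullet> j)))"
      by (subst euclidean_inner[of "X _" h]) simp
    finally show ?thesis by (simp add: sum_distrib_left algebra_simps)
  qed
  have "(LINT h:ball 0 \<rho>|lborel. k + q \<bullet> h + (1/2) * (X h \<bullet> h))
     = (LINT h:ball (0::'a) \<rho>|lborel. k) + (LINT h:ball 0 \<rho>|lborel. q \<bullet> h)
        + (LINT h:ball 0 \<rho>|lborel. (1/2) * (X h \<bullet> h))"
  proof -
    have cX: "continuous_on UNIV X" using X by (simp add: linear_continuous_on linear_conv_bounded_linear)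
    show ?thesis
      by (subst set_integral_add(2), (intro int continuous_intros cX)+,
          subst set_integral_add(2), (intro int continuous_intros cX)+) simp
  qed
  also have "(LINT h:ball (0::'a) \<rho>|lborel. k) = V * k"
    by (simp add: set_lebesgue_integral_def V_def)
  also have "(LINT h:ball 0 \<rho>|lborel. q \<bullet> h) = (\<Sum>i\<in>Basis. (q \<bullet> i) * (LINT h:ball 0 \<rho>|lborel. h \<bullet> i))"
  proof -
    have "integrable lborel (\<lambda>h::'a. indicator (ball 0 \<rho>) h * (h \<bullet> i))" for i :: 'a
      using int[of "\<lambda>h. h \<bullet> i"] by (simp add: set_integrable_def continuous_on_inner)
    then have "(LINT h:ball 0 \<rho>|lborel. \<Sum>i\<in>Basis. (q \<bullet> i) * (h \<bullet> i))
        = (\<Sum>i\<in>Basis. (q \<bullet> i) * (LINT h:ball 0 \<rho>|lborel. h \<bullet> i))"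
      unfolding set_lebesgue_integral_def
      by (simp add: sum_distrib_left mult.left_commute[of "indicator _ _"])
    moreover have "(\<lambda>h. q \<bullet> h) = (\<lambda>h. \<Sum>i\<in>Basis. (q \<bullet> i) * (h \<bullet> i))"
      by (rule ext) (rule euclidean_inner)
    ultimately show ?thesis by metis
  qed
  also have "\<dots> = 0" using lin by simp
  also have "(LINT h:ball 0 \<rho>|lborel. (1/2) * (X h \<bullet> h)) =
      (1/2) * (\<Sum>i\<in>Basis. \<Sum>j\<in>Basis. (X i \<bullet> j) * (LINT h:ball 0 \<rho>|lborel. (h \<bullet> i) * (h \<bullet> j)))"
  proof -
    have "integrable lborel (\<lambda>h::'a. indicator (ball 0 \<rho>) h * ((h \<bullet> i) * (h \<bullet> j)))" for i j :: 'a
      using int[of "\<lambda>h. (h \<bullet> i) * (h \<bullet> j)"]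
      by (simp add: set_integrable_def continuous_on_inner continuous_on_mult)
    then show ?thesis
      unfolding Xe set_lebesgue_integral_def
      by (simp add: sum_distrib_left mult.left_commute[of "indicator _ _"])
  qed
  also have "(\<Sum>i\<in>Basis. \<Sum>j\<in>Basis. (X i \<bullet> j) * (LINT h:ball 0 \<rho>|lborel. (h \<bullet> i) * (h \<bullet> j)))
      = (\<Sum>i\<in>Basis. (X i \<bullet> i) * c)"
  proof (intro sum.cong refl)
    fix i :: 'a assume i: "i \<in> Basis"
    have "(\<Sum>j\<in>Basis. (X i \<bullet> j) * (LINT h:ball 0 \<rho>|lborel. (h \<bullet> i) * (h \<bullet> j)))
        = (\<Sum>j\<in>Basis. if i = j then (X i \<bullet> j) * c else 0)"
      by (intro sum.cong) (auto simp: quad i)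
    also have "\<dots> = (X i \<bullet> i) * c" using i by simp
    finally show "(\<Sum>j\<in>Basis. (X i \<bullet> j) * (LINT h:ball 0 \<rho>|lborel. (h \<bullet> i) * (h \<bullet> j))) = (X i \<bullet> i) * c" .
  qed
  also have "\<dots> = c * (\<Sum>i\<in>Basis. X i \<bullet> i)" by (simp add: sum_distrib_left mult.commute)
  finally show ?thesis
    by (simp add: V_def[symmetric]) (simp add: c_def field_simps)
qed

section \<open>Second-order expansions and the p-Laplacian\<close>

text \<open>A second-order expansion at \<open>x\<close> in the sense of Peano. It determines the quadratic form of \<open>X\<close>, and
thereby the trace of \<open>X\<close> and the value \<open>\<langle>X q, q\<rangle>\<close>, which are all that the p-Laplacian sees.\<close>

definition jet2 :: "('a::euclidean_space \<Rightarrow> real) \<Rightarrow> 'a \<Rightarrow> 'a \<Rightarrow> ('a \<Rightarrow> 'a) \<Rightarrow> bool" where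
  "jet2 \<phi> x q X \<longleftrightarrow> linear X \<and>
     (\<forall>e>0. \<exists>r>0. \<forall>h. norm h < r \<longrightarrow>
        \<bar>\<phi> (x + h) - (\<phi> x + q \<bullet> h + (1/2) * (X h \<bullet> h))\<bar> \<le> e * (norm h)\<^sup>2)"

text \<open>The regularity extracted from a \<open>C\<^sup>2\<close> function: differentiability near \<open>x\<close> and a gradient that
is differentiable at \<open>x\<close>.\<close>

definition C2_at :: "('a::euclidean_space \<Rightarrow> real) \<Rightarrow> 'a \<Rightarrow> real \<Rightarrow> ('a \<Rightarrow> 'a) \<Rightarrow> bool" where
  "C2_at \<phi> x R X \<longleftrightarrow> R > 0 \<and> (\<forall>y\<in>ball x R. \<phi> differentiable (at y)) \<and> (grad \<phi> has_derivative X) (at x)"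

definition trace_op :: "('a::euclidean_space \<Rightarrow> 'a) \<Rightarrow> real" where
  "trace_op X = (\<Sum>i\<in>Basis. X i \<bullet> i)"

text \<open>The expression \<open>\<bar>q\<bar> powr (2 - p) * \<Delta>\<close> for a function with p-Laplacian \<open>\<Delta>\<close>, gradient \<open>q \<noteq> 0\<close> and
Hessian \<open>X\<close>.\<close>

definition normalized_plap :: "real \<Rightarrow> 'a::euclidean_space \<Rightarrow> ('a \<Rightarrow> 'a) \<Rightarrow> real" where
  "normalized_plap p q X = trace_op X + (p - 2) * (X q \<bullet> q) / (norm q)\<^sup>2"

lemma has_derivative_grad:
  assumes "\<phi> differentiable (at y)"
  shows "(\<phi> has_derivative (\<lambda>h. grad \<phi> y \<bullet> h)) (at y)"
proof -
  have d: "(\<phi> has_derivative frechet_derivative \<phi> (at y)) (at y)"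
    using assms frechet_derivative_works by blast
  then have lin: "linear (frechet_derivative \<phi> (at y))"
    by (rule has_derivative_linear)
  have "frechet_derivative \<phi> (at y) h = grad \<phi> y \<bullet> h" for h
  proof -
    have "frechet_derivative \<phi> (at y) h = frechet_derivative \<phi> (at y) (\<Sum>i\<in>Basis. (h \<bullet> i) *\<^sub>R i)"
      by (simp add: euclidean_representation)
    also have "\<dots> = grad \<phi> y \<bullet> h"
      by (simp add: linear_sum[OF lin] linear_scale[OF lin] grad_def inner_sum_left inner_sum_right
          inner_commute mult.commute)
    finally show ?thesis .
  qed
  then have "frechet_derivative \<phi> (at y) = (\<lambda>h. grad \<phi> y \<bullet> h)" by auto
  with d show ?thesis by simp
qed

lemma grad_eqI:
  assumes "(\<phi> has_derivative (\<lambda>h. v \<bullet> h)) (at y)"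
  shows "grad \<phi> y = v"
  using frechet_derivative_at[OF assms, symmetric]
  by (simp add: grad_def euclidean_representation)

lemma Ck_2_C2_at:
  assumes "Ck_on 2 \<phi> (ball x R)" "R > 0"
  obtains X where "C2_at \<phi> x R X"
proof -
  have d: "\<phi> differentiable (at y)" if "y \<in> ball x R" for y
    using assms that by (auto simp: numeral_2_eq_2 differentiable_on_eq_differentiable_at)
  have d2: "(\<lambda>y. frechet_derivative \<phi> (at y) i) differentiable (at x)" if "i \<in> Basis" for i
    using assms that by (auto simp: numeral_2_eq_2 differentiable_on_eq_differentiable_at)
  have "(\<lambda>y. \<Sum>i\<in>Basis. frechet_derivative \<phi> (at y) i *\<^sub>R i) differentiable (at x)"
    using d2 by (intro differentiable_sum differentiable_scaleR) auto
  then have "grad \<phi> differentiable (at x)"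
    by (simp add: grad_def[abs_def])
  then show ?thesis
    using that d assms(2) unfolding C2_at_def differentiable_def by blast
qed

text \<open>Apply the mean value theorem to the remainder along the segment from \<open>x\<close> to \<open>x + h\<close>; its
derivative is controlled by the differentiability of the gradient at \<open>x\<close>.\<close>

lemma C2_at_jet2:
  assumes "C2_at \<phi> x R X"
  shows "jet2 \<phi> x (grad \<phi> x) X"
  unfolding jet2_def
proof (intro conjI allI impI)
  have X: "(grad \<phi> has_derivative X) (at x)" and R: "R > 0"
    and d: "\<And>y. y \<in> ball x R \<Longrightarrow> \<phi> differentiable (at y)"
    using assms by (auto simp: C2_at_def)
  show "linear X" using X by (rule has_derivative_linear)
  fix e :: real assume e: "e > 0"
  obtain r where r: "r > 0"
    and rd: "\<And>y. norm (y - x) < r \<Longrightarrow> norm (grad \<phi> y - grad \<phi> x - X (y - x)) \<le> e * norm (y - x)"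
    using X e unfolding has_derivative_at_alt by metis
  show "\<exists>r>0. \<forall>h. norm h < r \<longrightarrow>
        \<bar>\<phi> (x + h) - (\<phi> x + grad \<phi> x \<bullet> h + (1/2) * (X h \<bullet> h))\<bar> \<le> e * (norm h)\<^sup>2"
  proof (intro exI[of _ "min r R"] conjI allI impI)
    fix h :: 'a assume h: "norm h < min r R"
    define \<psi> where "\<psi> t = \<phi> (x + t *\<^sub>R h) - t * (grad \<phi> x \<bullet> h) - (t\<^sup>2 / 2) * (X h \<bullet> h)" for t
    define \<psi>' where "\<psi>' t = grad \<phi> (x + t *\<^sub>R h) \<bullet> h - grad \<phi> x \<bullet> h - t * (X h \<bullet> h)" for t
    have nt: "norm (t *\<^sub>R h) \<le> norm h" if "0 \<le> t" "t \<le> 1" for t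
      using that by (simp add: mult_left_le_one_le)
    have der: "(\<psi> has_real_derivative \<psi>' t) (at t)" if t: "0 \<le> t" "t \<le> 1" for t
    proof -
      have "x + t *\<^sub>R h \<in> ball x R"
        using nt[OF t] h by (simp add: dist_norm)
      then have "(\<phi> has_derivative (\<lambda>k. grad \<phi> (x + t *\<^sub>R h) \<bullet> k)) (at (x + t *\<^sub>R h))"
        by (intro has_derivative_grad d)
      moreover have "((\<lambda>t. x + t *\<^sub>R h) has_derivative (\<lambda>s. s *\<^sub>R h)) (at t)"
        by (auto intro!: derivative_eq_intros)
      ultimately have "((\<lambda>t. \<phi> (x + t *\<^sub>R h)) has_derivative (\<lambda>s. grad \<phi> (x + t *\<^sub>R h) \<bullet> (s *\<^sub>R h))) (at t)"
        by (rule has_derivative_compose[rotated])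
      then have "((\<lambda>t. \<phi> (x + t *\<^sub>R h)) has_real_derivative grad \<phi> (x + t *\<^sub>R h) \<bullet> h) (at t)"
        by (simp add: has_field_derivative_def mult.commute[of _ "_ \<bullet> _"] fun_eq_iff)
      then show ?thesis
        unfolding \<psi>_def \<psi>'_def by (auto intro!: derivative_eq_intros)
    qed
    obtain z where z: "0 < z" "z < 1" "\<psi> 1 - \<psi> 0 = (1 - 0) * \<psi>' z"
      using MVT2[of 0 1 \<psi> \<psi>'] der by auto
    have "\<psi>' z = (grad \<phi> (x + z *\<^sub>R h) - grad \<phi> x - X (z *\<^sub>R h)) \<bullet> h"
      using \<open>linear X\<close> by (simp add: \<psi>'_def inner_diff_left linear_scale)
    then have "\<bar>\<psi>' z\<bar> \<le> norm (grad \<phi> (x + z *\<^sub>R h) - grad \<phi> x - X (z *\<^sub>R h)) * norm h"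
      by (simp add: Cauchy_Schwarz_ineq2)
    also have "\<dots> \<le> (e * norm (z *\<^sub>R h)) * norm h"
      using rd[of "x + z *\<^sub>R h"] nt[of z] z h by (intro mult_right_mono) auto
    also have "\<dots> \<le> (e * norm h) * norm h"
      using nt[of z] z e by (intro mult_right_mono mult_left_mono) auto
    finally have "\<bar>\<psi>' z\<bar> \<le> e * (norm h)\<^sup>2" by (simp add: power2_eq_square)
    then show "\<bar>\<phi> (x + h) - (\<phi> x + grad \<phi> x \<bullet> h + (1/2) * (X h \<bullet> h))\<bar> \<le> e * (norm h)\<^sup>2"
      using z by (simp add: \<psi>_def algebra_simps)
  qed (use r R in auto)
qed

text \<open>Near a critical point the gradient is \<open>O(\<bar>y - x\<bar>)\<close> and the factor \<open>\<bar>grad \<phi>\<bar> powr (p - 2)\<close> tends to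
\<open>0\<close>, so that the field is \<open>o(\<bar>y - x\<bar>)\<close>.\<close>

lemma p_laplacian_zero_gradient:
  assumes p: "p > 2" and X: "(grad \<phi> has_derivative X) (at x)" and q: "grad \<phi> x = 0"
  shows "p_laplacian p \<phi> x = 0"
proof -
  define F where "F y = (norm (grad \<phi> y) powr (p - 2)) *\<^sub>R grad \<phi> y" for y
  obtain K where K: "K > 0" "\<And>h. norm (X h) \<le> norm h * K"
    using bounded_linear.pos_bounded[OF has_derivative_bounded_linear[OF X]] by blast
  obtain r where r: "r > 0"
    and rd: "\<And>y. norm (y - x) < r \<Longrightarrow> norm (grad \<phi> y - grad \<phi> x - X (y - x)) \<le> 1 * norm (y - x)"
    using X unfolding has_derivative_at_alt by (metis zero_less_one)
  have G: "norm (grad \<phi> y) \<le> (1 + K) * norm (y - x)" if "norm (y - x) < r" for y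
  proof -
    have "norm (grad \<phi> y) \<le> norm (grad \<phi> y - grad \<phi> x - X (y - x)) + norm (X (y - x))"
      using norm_triangle_ineq[of "grad \<phi> y - grad \<phi> x - X (y - x)" "X (y - x)"] q by simp
    also have "\<dots> \<le> (1 + K) * norm (y - x)"
      using rd[OF that] K(2)[of "y - x"] by (simp add: algebra_simps)
    finally show ?thesis .
  qed
  have "(grad \<phi> \<longlongrightarrow> 0) (at x)"
    using has_derivative_continuous[OF X] q by (simp add: continuous_at)
  then have "((\<lambda>y. norm (grad \<phi> y) powr (p - 2)) \<longlongrightarrow> 0) (at x)"
    using p by (intro tendsto_zero_powrI[where b = "p - 2"] tendsto_norm_zero tendsto_const) auto
  then have small: "\<forall>\<^sub>F y in at x. norm (grad \<phi> y) powr (p - 2) < e" if "e > 0" for e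
    using that by (rule order_tendstoD(2))
  have "(F has_derivative (\<lambda>h. 0)) (at x)"
    unfolding has_derivative_at_alt
  proof (intro conjI allI impI)
    fix e :: real assume e: "e > 0"
    obtain s where s: "s > 0"
      and sd: "\<And>y. y \<noteq> x \<Longrightarrow> dist y x < s \<Longrightarrow> norm (grad \<phi> y) powr (p - 2) < e / (1 + K)"
      using small[of "e / (1 + K)"] e K(1) unfolding eventually_at by auto
    show "\<exists>d>0. \<forall>y. norm (y - x) < d \<longrightarrow> norm (F y - F x - 0) \<le> e * norm (y - x)"
    proof (intro exI[of _ "min r s"] conjI allI impI)
      fix y assume y: "norm (y - x) < min r s"
      show "norm (F y - F x - 0) \<le> e * norm (y - x)"
      proof (cases "y = x")
        case False
        have "norm (F y - F x - 0) = norm (grad \<phi> y) powr (p - 2) * norm (grad \<phi> y)"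
          using q by (simp add: F_def)
        also have "\<dots> \<le> (e / (1 + K)) * ((1 + K) * norm (y - x))"
          using sd[OF False] y G[of y] e K(1) by (intro mult_mono) (auto simp: dist_norm)
        also have "\<dots> = e * norm (y - x)" using K(1) by simp
        finally show ?thesis .
      qed auto
    qed (use r s in auto)
  qed simp
  then show ?thesis
    by (simp add: p_laplacian_def divergence_def F_def[abs_def] frechet_derivative_at[symmetric])
qed

lemma p_laplacian_nonzero_gradient:
  assumes X: "(grad \<phi> has_derivative X) (at x)" and q: "grad \<phi> x \<noteq> 0"
  shows "p_laplacian p \<phi> x = norm (grad \<phi> x) powr (p - 2) * normalized_plap p (grad \<phi> x) X"
proof -
  define q where "q = grad \<phi> x"
  define u where "u = norm q powr (p - 2)"
  have q0: "q \<noteq> 0" "norm q > 0" using q by (auto simp: q_def)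
  have lin: "linear X" using X by (rule has_derivative_linear)
  have N: "((\<lambda>y. norm (grad \<phi> y)) has_derivative (\<lambda>h. X h \<bullet> sgn q)) (at x)"
    using has_derivative_compose[OF X has_derivative_norm[OF q]] by (simp add: q_def)
  have "((\<lambda>z. z powr (p - 2)) has_real_derivative (p - 2) * norm q powr (p - 2 - 1)) (at (norm q))"
    using q0 by (intro has_real_derivative_powr)
  then have "((\<lambda>y. norm (grad \<phi> y) powr (p - 2)) has_derivative
      (\<lambda>h. (p - 2) * norm q powr (p - 2 - 1) * (X h \<bullet> sgn q))) (at x)"
    using has_derivative_compose[OF N, of "\<lambda>z. z powr (p - 2)"]
    by (simp add: has_field_derivative_def q_def)
  then have "((\<lambda>y. (norm (grad \<phi> y) powr (p - 2)) *\<^sub>R grad \<phi> y) has_derivative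
      (\<lambda>h. u *\<^sub>R X h + ((p - 2) * norm q powr (p - 2 - 1) * (X h \<bullet> sgn q)) *\<^sub>R q)) (at x)"
    using has_derivative_scaleR[OF _ X] by (simp add: u_def q_def)
  from frechet_derivative_at[OF this, symmetric]
  have "p_laplacian p \<phi> x = (\<Sum>i\<in>Basis.
      (u *\<^sub>R X i + ((p - 2) * norm q powr (p - 2 - 1) * (X i \<bullet> sgn q)) *\<^sub>R q) \<bullet> i)"
    by (simp add: p_laplacian_def divergence_def)
  also have "\<dots> = u * trace_op X + (p - 2) * norm q powr (p - 2 - 1) * (\<Sum>i\<in>Basis. (X i \<bullet> sgn q) * (q \<bullet> i))"
    by (simp add: trace_op_def inner_add_left sum.distrib sum_distrib_left mult.assoc)
  also have "(\<Sum>i\<in>Basis. (X i \<bullet> sgn q) * (q \<bullet> i)) = X q \<bullet> sgn q"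
  proof -
    have "X q = X (\<Sum>i\<in>Basis. (q \<bullet> i) *\<^sub>R i)" by (simp add: euclidean_representation)
    also have "\<dots> = (\<Sum>i\<in>Basis. (q \<bullet> i) *\<^sub>R X i)"
      by (simp add: linear_sum[OF lin] linear_scale[OF lin])
    finally show ?thesis by (simp add: inner_sum_left mult.commute)
  qed
  also have "norm q powr (p - 2 - 1) = u / norm q"
    using q0 by (subst powr_diff) (simp add: u_def)
  finally show ?thesis
    by (simp add: normalized_plap_def q_def[symmetric] u_def[symmetric] sgn_div_norm
        power2_eq_square distrib_left divide_simps)
qed

lemma p_laplacian_eq:
  assumes "p > 2" "(grad \<phi> has_derivative X) (at x)"
  shows "p_laplacian p \<phi> x =
    (if grad \<phi> x = 0 then 0 else norm (grad \<phi> x) powr (p - 2) * normalized_plap p (grad \<phi> x) X)"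
  using p_laplacian_zero_gradient p_laplacian_nonzero_gradient assms by auto

lemma C2_at_uminus:
  assumes "C2_at \<phi> x R X"
  shows "C2_at (\<lambda>y. - \<phi> y) x R (\<lambda>h. - X h)" and "grad (\<lambda>y. - \<phi> y) x = - grad \<phi> x"
proof -
  have X: "(grad \<phi> has_derivative X) (at x)" and R: "R > 0"
    and d: "\<And>y. y \<in> ball x R \<Longrightarrow> \<phi> differentiable (at y)"
    using assms by (auto simp: C2_at_def)
  have g: "grad (\<lambda>y. - \<phi> y) y = - grad \<phi> y" if "y \<in> ball x R" for y
    using has_derivative_minus[OF has_derivative_grad[OF d[OF that]]] by (intro grad_eqI) simp
  show "grad (\<lambda>y. - \<phi> y) x = - grad \<phi> x" using g R by simp
  have "(grad (\<lambda>y. - \<phi> y) has_derivative (\<lambda>h. - X h)) (at x)"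
    using has_derivative_minus[OF X]
    by (rule has_derivative_transform_within_open[where s = "ball x R"]) (use R g in auto)
  moreover have "(\<lambda>y. - \<phi> y) differentiable (at y)" if "y \<in> ball x R" for y
    using d[OF that] by (rule differentiable_minus)
  ultimately show "C2_at (\<lambda>y. - \<phi> y) x R (\<lambda>h. - X h)"
    using R by (simp add: C2_at_def)
qed

lemma p_laplacian_uminus:
  assumes "p > 2" "C2_at \<phi> x R X"
  shows "p_laplacian p (\<lambda>y. - \<phi> y) x = - p_laplacian p \<phi> x"
proof -
  have "linear X" using assms(2) by (auto simp: C2_at_def has_derivative_linear)
  then have "normalized_plap p (- q) (\<lambda>h. - X h) = - normalized_plap p q X" for q
    by (simp add: normalized_plap_def trace_op_def sum_negf linear_neg)
  then show ?thesis
    using p_laplacian_eq[OF assms(1), of \<phi> X x] p_laplacian_eq[OF assms(1), of "\<lambda>y. - \<phi> y" "\<lambda>h. - X h" x]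
      C2_at_uminus[OF assms(2)] assms(2)
    by (auto simp: C2_at_def)
qed

section \<open>Quadratic test functions\<close>

lemma Ck_on_const: "Ck_on k (\<lambda>y. c) S"
  by (induction k arbitrary: c) (auto simp: frechet_derivative_const)

lemma Ck_on_affine: "Ck_on k (\<lambda>y::'a::euclidean_space. b + c \<bullet> y) S"
proof (cases k)
  case 0
  then show ?thesis by (auto intro!: continuous_intros)
next
  case (Suc n)
  have D: "((\<lambda>y. b + c \<bullet> y) has_derivative (\<lambda>h. c \<bullet> h)) (at y)" for y
    by (auto intro!: derivative_eq_intros)
  have "(\<lambda>y. b + c \<bullet> y) differentiable_on S"
    using D by (auto simp: differentiable_on_def differentiable_def intro: has_derivative_at_withinI)
  then show ?thesis
    using Suc frechet_derivative_at[OF D, symmetric] by (simp add: Ck_on_const)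
qed

lemma symmetric_quadratic:
  fixes X :: "'a::euclidean_space \<Rightarrow> 'a" and a :: real and q x :: 'a
  assumes lin: "linear X" and sym: "\<And>u v. X u \<bullet> v = u \<bullet> X v"
  defines "P \<equiv> \<lambda>y. a + q \<bullet> (y - x) + (1/2) * (X (y - x) \<bullet> (y - x))"
  shows "Cinf_on P S" and "grad P = (\<lambda>y. q + X (y - x))"
    and "(grad P has_derivative X) (at y)"
proof -
  have bl: "bounded_linear X" using lin by (simp add: linear_conv_bounded_linear)
  have X: "((\<lambda>y. X (y - x)) has_derivative X) (at y)" for y
    by (rule bounded_linear.has_derivative[OF bl, THEN has_derivative_eq_rhs])
       (auto intro!: derivative_eq_intros)
  have D: "(P has_derivative (\<lambda>h. (q + X (y - x)) \<bullet> h)) (at y)" for y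
  proof (rule has_derivative_eq_rhs)
    show "(P has_derivative (\<lambda>h. 0 + q \<bullet> (h - 0) + (1/2) * (X (y - x) \<bullet> (h - 0) + X h \<bullet> (y - x)))) (at y)"
      unfolding P_def
      by (intro has_derivative_add has_derivative_const has_derivative_inner_right
          has_derivative_mult_right has_derivative_inner X has_derivative_diff has_derivative_ident)
    show "(\<lambda>h. 0 + q \<bullet> (h - 0) + (1/2) * (X (y - x) \<bullet> (h - 0) + X h \<bullet> (y - x))) = (\<lambda>h. (q + X (y - x)) \<bullet> h)"
      using sym[of _ "y - x"] by (simp add: inner_add_left inner_add_right fun_eq_iff inner_commute)
  qed
  show g: "grad P = (\<lambda>y. q + X (y - x))"
    using grad_eqI[OF D] by auto
  show "(grad P has_derivative X) (at y)"
    unfolding g by (rule derivative_eq_intros X | simp)+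
  have dP: "P differentiable_on S"
    using D by (auto simp: differentiable_on_def differentiable_def intro: has_derivative_at_withinI)
  have "Ck_on k P S" for k
  proof (cases k)
    case 0
    then show ?thesis using dP by (simp add: differentiable_imp_continuous_on)
  next
    case (Suc n)
    have "frechet_derivative P (at y) i = ((q - X x) \<bullet> i) + X i \<bullet> y" for i y
      unfolding frechet_derivative_at[OF D, symmetric] using sym[of i y]
      by (simp add: linear_diff[OF lin] inner_diff_left inner_add_left inner_diff_right inner_add_right inner_commute)
    then show ?thesis using Suc dP by (simp add: Ck_on_affine)
  qed
  then show "Cinf_on P S" by (simp add: Cinf_on_def)
qed

text \<open>The Taylor polynomial with its Hessian shifted by \<open>\<sigma>\<close> times the identity lies on one side of \<open>\<phi>\<close>
near \<open>x\<close>, according to the sign of \<open>\<sigma>\<close>, because the shift dominates the \<open>o(\<bar>y - x\<bar>\<^sup>2)\<close> remainder. It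
changes the p-Laplacian by an amount proportional to \<open>\<sigma>\<close>.\<close>

lemma quadratic_comparison:
  fixes \<phi> :: "'a::euclidean_space \<Rightarrow> real"
  assumes p: "p > 2" and C: "C2_at \<phi> x R X" and \<sigma>: "\<sigma> \<noteq> 0"
  obtains P r where "r > 0" "\<And>S. Cinf_on P S" "P x = \<phi> x" "grad P x = grad \<phi> x"
    "\<And>y. y \<in> ball x r \<Longrightarrow> \<sigma> * (P y - \<phi> y) \<ge> 0"
    "p_laplacian p P x = p_laplacian p \<phi> x +
       (if grad \<phi> x = 0 then 0 else \<sigma> * (norm (grad \<phi> x) powr (p - 2) * (real DIM('a) + p - 2)))"
proof -
  have X: "(grad \<phi> has_derivative X) (at x)" using C by (simp add: C2_at_def)
  have lin: "linear X" using X by (rule has_derivative_linear)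
  \<comment> \<open>The Hessian of a polynomial is symmetric, hence the symmetrisation of \<open>X\<close>, which has the
    same quadratic form and trace.\<close>
  define Y where "Y h = (1/2) *\<^sub>R (X h + adjoint X h) + \<sigma> *\<^sub>R h" for h
  have adj: "u \<bullet> adjoint X v = X u \<bullet> v" "adjoint X v \<bullet> u = X u \<bullet> v" for u v
    using adjoint_works[OF lin, of u v] by (simp_all add: inner_commute)
  have linY: "linear Y"
    unfolding Y_def using lin adjoint_linear[OF lin]
    by (intro linear_compose_add linear_compose_scale_right linear_id[unfolded id_def])
  have symY: "Y u \<bullet> v = u \<bullet> Y v" for u v
    by (simp add: Y_def inner_add_left inner_add_right adj) (simp add: inner_commute)
  have quadY: "Y h \<bullet> h = X h \<bullet> h + \<sigma> * (norm h)\<^sup>2" for h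
    by (simp add: Y_def inner_add_left adj power2_norm_eq_inner)
  define P where "P y = \<phi> x + grad \<phi> x \<bullet> (y - x) + (1/2) * (Y (y - x) \<bullet> (y - x))" for y
  note Q = symmetric_quadratic[OF linY symY, where a = "\<phi> x" and q = "grad \<phi> x" and x = x, folded P_def]
  have gP: "grad P x = grad \<phi> x" using linY by (simp add: Q(2) linear_0)
  obtain r where r: "r > 0" and rd: "\<And>h. norm h < r \<Longrightarrow>
      \<bar>\<phi> (x + h) - (\<phi> x + grad \<phi> x \<bullet> h + (1/2) * (X h \<bullet> h))\<bar> \<le> (\<bar>\<sigma>\<bar> / 2) * (norm h)\<^sup>2"
    using C2_at_jet2[OF C] \<sigma> unfolding jet2_def by (meson half_gt_zero zero_less_abs_iff)
  show ?thesis
  proof (rule that[of r P])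
    show "r > 0" by fact
    show "Cinf_on P S" for S by (rule Q(1))
    show "P x = \<phi> x" using linY by (simp add: P_def linear_0)
    show "grad P x = grad \<phi> x" by fact
    show "\<sigma> * (P y - \<phi> y) \<ge> 0" if "y \<in> ball x r" for y
    proof -
      define h where "h = y - x"
      have h: "norm h < r" "y = x + h" using that by (auto simp: h_def dist_norm norm_minus_commute)
      define E where "E = \<phi> y - (\<phi> x + grad \<phi> x \<bullet> h + (1/2) * (X h \<bullet> h))"
      have E: "\<bar>E\<bar> \<le> (\<bar>\<sigma>\<bar> / 2) * (norm h)\<^sup>2" using rd[OF h(1)] h(2) by (simp add: E_def)
      have "P y - \<phi> y = (\<sigma> / 2) * (norm h)\<^sup>2 - E"
        by (simp add: P_def E_def h_def[symmetric] quadY algebra_simps)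
      then have "\<sigma> * (P y - \<phi> y) = (\<sigma>\<^sup>2 / 2) * (norm h)\<^sup>2 - \<sigma> * E"
        by (simp add: right_diff_distrib power2_eq_square)
      moreover have "\<bar>\<sigma> * E\<bar> \<le> (\<sigma>\<^sup>2 / 2) * (norm h)\<^sup>2"
        using mult_left_mono[OF E, of "\<bar>\<sigma>\<bar>"] by (simp add: abs_mult power2_eq_square)
      ultimately show ?thesis by linarith
    qed
    have tr: "trace_op Y = trace_op X + \<sigma> * real DIM('a)"
      unfolding trace_op_def using quadY by (simp add: sum.distrib)
    have N: "normalized_plap p (grad \<phi> x) Y = normalized_plap p (grad \<phi> x) X + \<sigma> * (real DIM('a) + p - 2)"
      if "grad \<phi> x \<noteq> 0"
      using that by (simp add: normalized_plap_def quadY tr field_simps)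
    then show "p_laplacian p P x = p_laplacian p \<phi> x +
       (if grad \<phi> x = 0 then 0 else \<sigma> * (norm (grad \<phi> x) powr (p - 2) * (real DIM('a) + p - 2)))"
      unfolding p_laplacian_eq[OF p Q(3)[of x]] p_laplacian_eq[OF p X] gP
      by (simp add: N del: mult_cancel_left) (simp add: algebra_simps)
  qed
qed

section \<open>Suprema and means over small balls\<close>

lemma jet2_uminus:
  assumes "jet2 \<phi> x q X"
  shows "jet2 (\<lambda>y. - \<phi> y) x (- q) (\<lambda>h. - X h)"
proof -
  have "\<bar>- \<phi> (x + h) - (- \<phi> x + - q \<bullet> h + (1/2) * (- X h \<bullet> h))\<bar>
      = \<bar>\<phi> (x + h) - (\<phi> x + q \<bullet> h + (1/2) * (X h \<bullet> h))\<bar>" for h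
    by (simp add: abs_minus_commute algebra_simps)
  then show ?thesis
    using assms unfolding jet2_def by (auto intro: linear_compose_neg)
qed

text \<open>The linear part favours the point \<open>\<rho> q / \<bar>q\<bar>\<close> of the sphere. At a point at distance \<open>D\<close> from it, the
linear part loses at least \<open>\<bar>q\<bar> D\<^sup>2 / (2 \<rho>)\<close>, while the quadratic part gains at most a constant
times \<open>\<rho> D\<close>; the balance is at most \<open>O(\<rho>\<^sup>3)\<close>. Hence, up to \<open>o(\<rho>\<^sup>2)\<close>, the supremum is the value
at \<open>\<rho> q / \<bar>q\<bar>\<close>.\<close>

lemma jet2_SUP:
  assumes J: "jet2 \<phi> x q X" and q: "q \<noteq> 0" and e: "e > 0"
  shows "\<forall>\<^sub>F \<rho> in at_right 0.
     \<bar>(SUP y\<in>ball x \<rho>. \<phi> y) - (\<phi> x + \<rho> * norm q + \<rho>\<^sup>2 / 2 * ((X q \<bullet> q) / (norm q)\<^sup>2))\<bar> \<le> e * \<rho>\<^sup>2"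
proof -
  define g where "g = norm q"
  define n where "n = q /\<^sub>R g"
  have g: "g > 0" using q by (simp add: g_def)
  have n: "norm n = 1" "q = g *\<^sub>R n" using g by (auto simp: n_def g_def)
  have lin: "linear X" using J by (simp add: jet2_def)
  obtain K where K: "K > 0" "\<And>h. norm (X h) \<le> norm h * K"
    using bounded_linear.pos_bounded[OF lin[unfolded linear_conv_bounded_linear]] by blast
  have Xn: "(X q \<bullet> q) / (norm q)\<^sup>2 = X n \<bullet> n"
    using g by (simp add: n_def linear_scale[OF lin] power2_eq_square g_def[symmetric] divide_simps)
  obtain r1 where r1: "r1 > 0" and jr: "\<And>h. norm h < r1 \<Longrightarrow>
      \<bar>\<phi> (x + h) - (\<phi> x + q \<bullet> h + (1/2) * (X h \<bullet> h))\<bar> \<le> (e / 2) * (norm h)\<^sup>2"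
    using J e unfolding jet2_def by (meson half_gt_zero)
  define r where "r = min r1 (e * g / K\<^sup>2)"
  have r: "r > 0" using r1 e g K by (simp add: r_def)
  show ?thesis
    unfolding eventually_at_right_field
  proof (intro exI[of _ r] conjI allI impI r)
    fix \<rho> assume "0 < \<rho>" "\<rho> < r"
    then have \<rho>: "0 < \<rho> \<and> \<rho> < r" by simp
    define U where "U = \<phi> x + \<rho> * g + \<rho>\<^sup>2 / 2 * (X n \<bullet> n)"
    have up: "\<phi> y \<le> U + e * \<rho>\<^sup>2" if "y \<in> ball x \<rho>" for y
    proof -
      define h where "h = y - x"
      have h: "norm h < \<rho>" "y = x + h" using that by (auto simp: h_def dist_norm norm_minus_commute)
      define v where "v = \<rho> *\<^sub>R n"
      define D where "D = norm (h - v)"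
      have nv: "norm v = \<rho>" using n \<rho> by (simp add: v_def)
      have "D\<^sup>2 = (norm h)\<^sup>2 - 2 * \<rho> * (n \<bullet> h) + \<rho>\<^sup>2"
        unfolding D_def power2_norm_eq_inner using n(1)
        by (simp add: v_def inner_diff_left inner_diff_right inner_commute power2_eq_square
            norm_eq_1 algebra_simps)
      moreover have "(norm h)\<^sup>2 \<le> \<rho>\<^sup>2" using h by (simp add: power_mono)
      ultimately have "D\<^sup>2 \<le> 2 * \<rho> * (\<rho> - n \<bullet> h)" by (simp add: power2_eq_square algebra_simps)
      then have "n \<bullet> h \<le> \<rho> - D\<^sup>2 / (2 * \<rho>)" using \<rho> by (simp add: field_simps)
      then have 1: "q \<bullet> h \<le> g * \<rho> - g * D\<^sup>2 / (2 * \<rho>)"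
        using mult_left_mono[of "n \<bullet> h" "\<rho> - D\<^sup>2 / (2 * \<rho>)" g] g by (simp add: n(2) right_diff_distrib)
      have "X h \<bullet> h - X v \<bullet> v = X (h - v) \<bullet> h + X v \<bullet> (h - v)"
        by (simp add: linear_diff[OF lin] inner_diff_left inner_diff_right)
      also have "\<dots> \<le> norm (X (h - v)) * norm h + norm (X v) * norm (h - v)"
        by (intro add_mono norm_cauchy_schwarz)
      also have "\<dots> \<le> (D * K) * \<rho> + (\<rho> * K) * D"
        using K(2)[of "h - v"] K(2)[of v] h K(1) nv by (intro add_mono mult_mono) (auto simp: D_def)
      finally have 2: "X h \<bullet> h \<le> \<rho>\<^sup>2 * (X n \<bullet> n) + 2 * K * \<rho> * D"
        by (simp add: v_def linear_scale[OF lin] power2_eq_square algebra_simps)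
      \<comment> \<open>Completing the square in \<open>D\<close>.\<close>
      have "0 \<le> g / (2 * \<rho>) * (D - K * \<rho>\<^sup>2 / g)\<^sup>2" using g \<rho> by simp
      also have "\<dots> = g * D\<^sup>2 / (2 * \<rho>) - K * \<rho> * D + K\<^sup>2 * \<rho> * \<rho>\<^sup>2 / (2 * g)"
        using g \<rho> by (simp add: power2_eq_square field_simps)
      finally have 3: "K * \<rho> * D - g * D\<^sup>2 / (2 * \<rho>) \<le> K\<^sup>2 * \<rho> / (2 * g) * \<rho>\<^sup>2" by simp
      have "\<rho> \<le> e * g / K\<^sup>2" using \<rho> by (simp add: r_def)
      then have "K\<^sup>2 * \<rho> / (2 * g) \<le> e / 2" using K g by (simp add: field_simps)
      then have 4: "K\<^sup>2 * \<rho> / (2 * g) * \<rho>\<^sup>2 \<le> e / 2 * \<rho>\<^sup>2" by (intro mult_right_mono) auto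
      with 3 have 34: "K * \<rho> * D - g * D\<^sup>2 / (2 * \<rho>) \<le> e / 2 * \<rho>\<^sup>2" by linarith
      have 5: "e / 2 * (norm h)\<^sup>2 \<le> e / 2 * \<rho>\<^sup>2"
        using e \<open>(norm h)\<^sup>2 \<le> \<rho>\<^sup>2\<close> by (intro mult_left_mono) auto
      have "norm h < r1" using h \<rho> by (simp add: r_def)
      define Z where "Z = g * D\<^sup>2 / (2 * \<rho>)"
      note 1[folded Z_def] 34[folded Z_def]
      with abs_le_D1[OF jr[OF \<open>norm h < r1\<close>]] 2 5 show ?thesis
        unfolding U_def h(2) by (simp add: algebra_simps)
    qed
    then have bdd: "bdd_above (\<phi> ` ball x \<rho>)" by (intro bdd_aboveI2)
    have ne: "ball x \<rho> \<noteq> {}" using \<rho> by simp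
    have "(SUP y\<in>ball x \<rho>. \<phi> y) \<le> U + e * \<rho>\<^sup>2"
      using up by (rule cSUP_least[OF ne])
    \<comment> \<open>The ball is open, so the maximising point of the sphere is approached from inside.\<close>
    moreover have "U - e * \<rho>\<^sup>2 \<le> (SUP y\<in>ball x \<rho>. \<phi> y)"
    proof (rule tendsto_upperbound)
      let ?low = "\<lambda>t. \<phi> x + t * g + t\<^sup>2 / 2 * (X n \<bullet> n) - e * t\<^sup>2"
      show "(?low \<longlongrightarrow> U - e * \<rho>\<^sup>2) (at_left \<rho>)"
        unfolding U_def by (intro tendsto_intros) auto
      show "\<forall>\<^sub>F t in at_left \<rho>. ?low t \<le> (SUP y\<in>ball x \<rho>. \<phi> y)"
        unfolding eventually_at_left_field
      proof (intro exI[of _ 0] conjI allI impI)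
        fix t :: real assume t: "0 < t" "t < \<rho>"
        have nt: "norm (t *\<^sub>R n) = t" using n t by simp
        then have "norm (t *\<^sub>R n) < r1" using t \<rho> by (simp add: r_def)
        from jr[OF this] have "\<phi> (x + t *\<^sub>R n) \<ge> \<phi> x + q \<bullet> (t *\<^sub>R n) + (1/2) * (X (t *\<^sub>R n) \<bullet> (t *\<^sub>R n)) - (e / 2) * t\<^sup>2"
          unfolding nt by linarith
        moreover have "q \<bullet> (t *\<^sub>R n) = t * g" using n by (simp add: norm_eq_1)
        moreover have "X (t *\<^sub>R n) \<bullet> (t *\<^sub>R n) = t\<^sup>2 * (X n \<bullet> n)"
          by (simp add: linear_scale[OF lin] power2_eq_square)
        moreover have "(e / 2) * t\<^sup>2 \<le> e * t\<^sup>2" using e by (intro mult_right_mono) auto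
        ultimately have "?low t \<le> \<phi> (x + t *\<^sub>R n)" using t by auto
        also have "\<dots> \<le> (SUP y\<in>ball x \<rho>. \<phi> y)"
          using t nt by (intro cSUP_upper[OF _ bdd]) (auto simp: dist_norm)
        finally show "?low t \<le> (SUP y\<in>ball x \<rho>. \<phi> y)" .
      qed (use \<rho> in auto)
    qed simp
    ultimately have "\<bar>(SUP y\<in>ball x \<rho>. \<phi> y) - U\<bar> \<le> e * \<rho>\<^sup>2" by simp
    then show "\<bar>(SUP y\<in>ball x \<rho>. \<phi> y) - (\<phi> x + \<rho> * norm q + \<rho>\<^sup>2 / 2 * ((X q \<bullet> q) / (norm q)\<^sup>2))\<bar> \<le> e * \<rho>\<^sup>2"
      unfolding Xn U_def g_def .
  qed
qed

lemma INF_eq_uminus_SUP: "(INF y\<in>S. \<phi> y) = - (SUP y\<in>S. - \<phi> y :: real)"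
  by (simp add: Inf_real_def image_image)

text \<open>Applying \<open>jet2_SUP\<close> to \<open>\<phi>\<close> and to \<open>- \<phi>\<close>, the first-order terms cancel in the average of supremum and
infimum, and the second-order terms agree.\<close>

lemma jet2_midrange:
  assumes J: "jet2 \<phi> x q X" and q: "q \<noteq> 0" and e: "e > 0"
  shows "\<forall>\<^sub>F \<rho> in at_right 0.
     \<bar>((1/2) * (SUP y\<in>ball x \<rho>. \<phi> y) + (1/2) * (INF y\<in>ball x \<rho>. \<phi> y))
       - (\<phi> x + \<rho>\<^sup>2 / 2 * ((X q \<bullet> q) / (norm q)\<^sup>2))\<bar> \<le> e * \<rho>\<^sup>2"
proof -
  have lin: "linear X" using J by (simp add: jet2_def)
  have "- q \<noteq> 0" using q by simp
  from jet2_SUP[OF jet2_uminus[OF J] this e]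
  have "\<forall>\<^sub>F \<rho> in at_right 0.
     \<bar>(SUP y\<in>ball x \<rho>. - \<phi> y) - (- \<phi> x + \<rho> * norm q - \<rho>\<^sup>2 / 2 * ((X q \<bullet> q) / (norm q)\<^sup>2))\<bar> \<le> e * \<rho>\<^sup>2"
    by (simp add: linear_neg[OF lin])
  with jet2_SUP[OF J q e] show ?thesis
  proof eventually_elim
    case (elim \<rho>)
    then show ?case
      unfolding INF_eq_uminus_SUP by (simp add: abs_le_iff)
  qed
qed

lemma jet2_average:
  fixes \<phi> :: "'a::euclidean_space \<Rightarrow> real"
  assumes J: "jet2 \<phi> x q X" and R: "R > 0" and cont: "continuous_on (ball x R) \<phi>" and e: "e > 0"
  shows "\<forall>\<^sub>F \<rho> in at_right 0.
     \<bar>1 / measure lborel (ball x \<rho>) * (LINT y:ball x \<rho>|lborel. \<phi> y)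
       - (\<phi> x + \<rho>\<^sup>2 / (2 * (real DIM('a) + 2)) * trace_op X)\<bar> \<le> e * \<rho>\<^sup>2"
proof -
  have lin: "linear X" using J by (simp add: jet2_def)
  obtain r1 where r1: "r1 > 0" and jr: "\<And>h. norm h < r1 \<Longrightarrow>
      \<bar>\<phi> (x + h) - (\<phi> x + q \<bullet> h + (1/2) * (X h \<bullet> h))\<bar> \<le> e * (norm h)\<^sup>2"
    using J e unfolding jet2_def by meson
  show ?thesis
    unfolding eventually_at_right_field
  proof (intro exI[of _ "min r1 R"] conjI allI impI)
    fix \<rho> assume \<rho>: "0 < \<rho>" "\<rho> < min r1 R"
    define V where "V = measure lborel (ball x \<rho>)"
    have V: "V > 0" using \<rho> by (simp add: V_def content_ball_pos)
    have V0: "measure lborel (ball (0::'a) \<rho>) = V"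
      using \<rho> by (simp add: V_def content_ball)
    define I where "I = (LINT y:ball x \<rho>|lborel. \<phi> y)"
    define t where "t = \<rho>\<^sup>2 / (2 * (real DIM('a) + 2)) * trace_op X"
    have i1: "set_integrable lborel (ball x \<rho>) \<phi>"
      using \<rho> by (intro set_integrable_ball continuous_on_subset[OF cont]) auto
    have I: "I = (LINT h:ball 0 \<rho>|lborel. \<phi> (x + h))"
      unfolding I_def by (rule set_integral_translate_ball[OF i1])
    have i2: "set_integrable lborel (ball 0 \<rho>) (\<lambda>h. \<phi> (x + h))"
      using \<rho> by (intro set_integrable_ball continuous_on_compose2[OF cont] continuous_intros)
         (auto simp: dist_norm)
    have cX: "continuous_on S X" for S
      using lin by (simp add: linear_continuous_on linear_conv_bounded_linear)
    have i3: "set_integrable lborel (ball 0 \<rho>) (\<lambda>h. k + q \<bullet> h + (1/2) * (X h \<bullet> h))" for k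
      by (intro set_integrable_ball continuous_intros cX)
    have q3: "(LINT h:ball 0 \<rho>|lborel. k + q \<bullet> h + (1/2) * (X h \<bullet> h)) = V * (k + t)" for k
      using set_integral_ball_quadratic[OF lin \<rho>(1), of k q] by (simp add: V0 t_def trace_op_def)
    have bd: "\<bar>\<phi> (x + h) - (\<phi> x + q \<bullet> h + (1/2) * (X h \<bullet> h))\<bar> \<le> e * \<rho>\<^sup>2" if "h \<in> ball 0 \<rho>" for h
    proof -
      have h: "norm h < \<rho>" using that by simp
      have "e * (norm h)\<^sup>2 \<le> e * \<rho>\<^sup>2" using h e by (intro mult_left_mono power_mono) auto
      then show ?thesis using jr[of h] h \<rho> by simp
    qed
    have "I \<le> V * (\<phi> x + e * \<rho>\<^sup>2 + t)"
      unfolding I q3[symmetric] using bd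
      by (intro set_integral_mono[OF i2 i3]) (fastforce simp: abs_le_iff)
    moreover have "V * (\<phi> x - e * \<rho>\<^sup>2 + t) \<le> I"
      unfolding I q3[symmetric] using bd
      by (intro set_integral_mono[OF i3 i2]) (fastforce simp: abs_le_iff)
    ultimately have "I / V \<le> \<phi> x + e * \<rho>\<^sup>2 + t" "\<phi> x - e * \<rho>\<^sup>2 + t \<le> I / V"
      using V by (simp_all add: field_simps)
    then show "\<bar>1 / measure lborel (ball x \<rho>) * (LINT y:ball x \<rho>|lborel. \<phi> y)
       - (\<phi> x + \<rho>\<^sup>2 / (2 * (real DIM('a) + 2)) * trace_op X)\<bar> \<le> e * \<rho>\<^sup>2"
      unfolding V_def[symmetric] I_def[symmetric] t_def[symmetric] by (simp add: abs_le_iff)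
  qed (use r1 R in auto)
qed

lemma eventually_at_right_scale:
  assumes "c > 0" "\<forall>\<^sub>F \<rho> in at_right (0::real). P \<rho>"
  shows "\<forall>\<^sub>F r in at_right 0. P (c * r)"
proof -
  obtain b where b: "b > 0" "\<And>y. 0 < y \<Longrightarrow> y < b \<Longrightarrow> P y"
    using assms(2) unfolding eventually_at_right_field by auto
  show ?thesis
    unfolding eventually_at_right_field
    using b assms(1) by (intro exI[of _ "b / c"]) (auto simp: field_simps)
qed

lemma gamma_const_props:
  assumes "p > 2"
  shows "gamma_const p d > 0" "(gamma_const p d * r)\<^sup>2 = 2 * (p + real d) * r\<^sup>2"
  using assms by (auto simp: gamma_const_def power_mult_distrib)

text \<open>With \<open>\<gamma>\<^sup>2 = 2 (p + d)\<close>, the identities \<open>\<beta> (p + d) = p - 2\<close> and \<open>(1 - \<beta>) (p + d) = d + 2\<close> turn the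
two expansions into the two parts of the normalised p-Laplacian.\<close>

lemma mean_op_nonzero_gradient:
  fixes \<phi> :: "'a::euclidean_space \<Rightarrow> real"
  assumes p: "p > 2" and J: "jet2 \<phi> x q X" and q: "q \<noteq> 0"
    and R: "R > 0" and cont: "continuous_on (ball x R) \<phi>" and e: "e > 0"
  shows "\<forall>\<^sub>F r in at_right 0. \<bar>(mean_op p r \<phi> x - \<phi> x) - normalized_plap p q X * r\<^sup>2\<bar> \<le> e * r\<^sup>2"
proof -
  define d where "d = real DIM('a)"
  define \<gamma> where "\<gamma> = gamma_const p DIM('a)"
  define e' where "e' = e / (2 * (p + d))"
  have d: "d > 0" by (simp add: d_def)
  have e': "e' > 0" using e p d by (simp add: e'_def)
  have g: "\<gamma> > 0" "\<And>r. (\<gamma> * r)\<^sup>2 = 2 * (p + d) * r\<^sup>2"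
    using gamma_const_props[OF p] by (auto simp: \<gamma>_def d_def)
  define \<beta> where "\<beta> = beta_const p DIM('a)"
  have \<beta>: "0 \<le> \<beta>" "\<beta> \<le> 1" "\<beta> * (p + d) = p - 2" "(1 - \<beta>) * (p + d) = d + 2"
    using p d by (auto simp: \<beta>_def beta_const_def d_def[symmetric] field_simps)
  define Q where "Q = (X q \<bullet> q) / (norm q)\<^sup>2"
  show ?thesis
    using eventually_at_right_scale[OF g(1) jet2_midrange[OF J q e']]
      eventually_at_right_scale[OF g(1) jet2_average[OF J R cont e']]
  proof eventually_elim
    case (elim r)
    let ?B = "ball x (\<gamma> * r)"
    define a where "a = (1/2) * (SUP y\<in>?B. \<phi> y) + (1/2) * (INF y\<in>?B. \<phi> y)"
    define b where "b = 1 / measure lborel ?B * (LINT y:?B|lborel. \<phi> y)"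
    have "mean_op p r \<phi> x = \<beta> * a + (1 - \<beta>) * b"
      by (simp add: mean_op_def Let_def a_def b_def \<beta>_def \<gamma>_def)
    moreover have "normalized_plap p q X * r\<^sup>2 =
        \<beta> * ((\<gamma> * r)\<^sup>2 / 2 * Q) + (1 - \<beta>) * ((\<gamma> * r)\<^sup>2 / (2 * (d + 2)) * trace_op X)"
    proof -
      have "\<beta> * ((\<gamma> * r)\<^sup>2 / 2 * Q) = (\<beta> * (p + d)) * (r\<^sup>2 * Q)"
        unfolding g by simp
      moreover have "(1 - \<beta>) * ((\<gamma> * r)\<^sup>2 / (2 * (d + 2)) * trace_op X)
         = ((1 - \<beta>) * (p + d)) * (r\<^sup>2 / (d + 2) * trace_op X)"
        unfolding g by (simp add: divide_simps) (simp add: algebra_simps)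
      moreover have "(d + 2) * (r\<^sup>2 / (d + 2) * trace_op X) = r\<^sup>2 * trace_op X"
        using d by simp
      moreover have "normalized_plap p q X * r\<^sup>2 = (p - 2) * (r\<^sup>2 * Q) + r\<^sup>2 * trace_op X"
        by (simp add: normalized_plap_def Q_def algebra_simps)
      ultimately show ?thesis
        by (simp only: \<beta>)
    qed
    ultimately have "(mean_op p r \<phi> x - \<phi> x) - normalized_plap p q X * r\<^sup>2 =
       \<beta> * (a - (\<phi> x + (\<gamma> * r)\<^sup>2 / 2 * Q)) + (1 - \<beta>) * (b - (\<phi> x + (\<gamma> * r)\<^sup>2 / (2 * (d + 2)) * trace_op X))"
      by (simp add: algebra_simps)
    also have "\<bar>\<dots>\<bar> \<le> \<beta> * (e' * (\<gamma> * r)\<^sup>2) + (1 - \<beta>) * (e' * (\<gamma> * r)\<^sup>2)"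
      using elim \<beta>
      by (intro order_trans[OF abs_triangle_ineq] add_mono)
         (auto simp: abs_mult a_def b_def Q_def d_def intro!: mult_left_mono)
    also have "\<dots> = e' * (\<gamma> * r)\<^sup>2" by (simp add: algebra_simps)
    also have "\<dots> = e * r\<^sup>2" unfolding g e'_def using p d by simp
    finally show ?case .
  qed
qed

lemma jet2_zero_gradient_bound:
  assumes J: "jet2 \<phi> x 0 X"
  obtains K r where "K > 0" "r > 0" "\<And>\<rho>. 0 < \<rho> \<Longrightarrow> \<rho> < r \<Longrightarrow> 0 \<le> (SUP y\<in>ball x \<rho>. \<phi> y) - \<phi> x"
    "\<And>\<rho>. 0 < \<rho> \<Longrightarrow> \<rho> < r \<Longrightarrow> (SUP y\<in>ball x \<rho>. \<phi> y) - \<phi> x \<le> K * \<rho>\<^sup>2"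
proof -
  have lin: "linear X" using J by (simp add: jet2_def)
  obtain C where C: "C > 0" "\<And>h. norm (X h) \<le> norm h * C"
    using bounded_linear.pos_bounded[OF lin[unfolded linear_conv_bounded_linear]] by blast
  obtain r where r: "r > 0" and jr: "\<And>h. norm h < r \<Longrightarrow>
      \<bar>\<phi> (x + h) - (\<phi> x + 0 \<bullet> h + (1/2) * (X h \<bullet> h))\<bar> \<le> 1 * (norm h)\<^sup>2"
    using J unfolding jet2_def by (meson zero_less_one)
  define K where "K = C / 2 + 1"
  have up: "\<phi> y \<le> \<phi> x + K * \<rho>\<^sup>2" if "y \<in> ball x \<rho>" "0 < \<rho>" "\<rho> < r" for y \<rho>
  proof -
    define h where "h = y - x"
    have h: "norm h < \<rho>" "y = x + h" using that by (auto simp: h_def dist_norm norm_minus_commute)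
    have "X h \<bullet> h \<le> norm (X h) * norm h" by (rule norm_cauchy_schwarz)
    also have "\<dots> \<le> (norm h * C) * norm h" by (intro mult_right_mono C) auto
    finally have "\<phi> y \<le> \<phi> x + K * (norm h)\<^sup>2"
      using jr[of h] h that unfolding K_def h(2) by (simp add: abs_le_iff power2_eq_square algebra_simps)
    moreover have "K * (norm h)\<^sup>2 \<le> K * \<rho>\<^sup>2"
      using h C by (intro mult_left_mono power_mono) (auto simp: K_def)
    ultimately show ?thesis by simp
  qed
  show ?thesis
  proof (rule that[of K r])
    show "K > 0" using C by (simp add: K_def)
    show "r > 0" by fact
    fix \<rho> assume \<rho>: "0 < \<rho>" "\<rho> < r"
    have "bdd_above (\<phi> ` ball x \<rho>)" using up \<rho> by (intro bdd_aboveI2)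
    then show "0 \<le> (SUP y\<in>ball x \<rho>. \<phi> y) - \<phi> x"
      using cSUP_upper[of x "ball x \<rho>" \<phi>] \<rho> by simp
    show "(SUP y\<in>ball x \<rho>. \<phi> y) - \<phi> x \<le> K * \<rho>\<^sup>2"
      using cSUP_least[of "ball x \<rho>" \<phi> "\<phi> x + K * \<rho>\<^sup>2"] up \<rho> by simp
  qed
qed

lemma SUP_ball_first_order:
  assumes J: "jet2 \<phi> x q X" and e: "e > 0"
  shows "\<forall>\<^sub>F \<rho> in at_right 0. \<bar>((SUP y\<in>ball x \<rho>. \<phi> y) - \<phi> x) - norm q * \<rho>\<bar> \<le> e * \<rho>"
proof -
  obtain K r where K: "K > 0" "r > 0" "\<And>\<rho>. 0 < \<rho> \<Longrightarrow> \<rho> < r \<Longrightarrow>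
      \<bar>((SUP y\<in>ball x \<rho>. \<phi> y) - \<phi> x) - norm q * \<rho>\<bar> \<le> K * \<rho>\<^sup>2"
  proof (cases "q = 0")
    case True
    from jet2_zero_gradient_bound[OF J[unfolded True]] True show ?thesis
      by (metis (no_types, lifting) that abs_of_nonneg diff_zero mult_zero_left norm_zero)
  next
    case False
    obtain r where r: "r > 0" "\<And>\<rho>. 0 < \<rho> \<Longrightarrow> \<rho> < r \<Longrightarrow>
       \<bar>(SUP y\<in>ball x \<rho>. \<phi> y) - (\<phi> x + \<rho> * norm q + \<rho>\<^sup>2 / 2 * ((X q \<bullet> q) / (norm q)\<^sup>2))\<bar> \<le> 1 * \<rho>\<^sup>2"
      using jet2_SUP[OF J False zero_less_one] unfolding eventually_at_right_field by blast
    define c where "c = (X q \<bullet> q) / (norm q)\<^sup>2"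
    show ?thesis
    proof (rule that[of "1 + \<bar>c\<bar>" r])
      fix \<rho> assume \<rho>: "0 < \<rho>" "\<rho> < r"
      have "\<bar>\<rho>\<^sup>2 / 2 * c\<bar> \<le> \<bar>c\<bar> * \<rho>\<^sup>2" by (simp add: abs_mult)
      then show "\<bar>((SUP y\<in>ball x \<rho>. \<phi> y) - \<phi> x) - norm q * \<rho>\<bar> \<le> (1 + \<bar>c\<bar>) * \<rho>\<^sup>2"
        using r(2)[OF \<rho>] unfolding c_def[symmetric] by (simp add: algebra_simps abs_le_iff)
    qed (use r in auto)
  qed
  show ?thesis
    unfolding eventually_at_right_field
  proof (intro exI[of _ "min r (e / K)"] conjI allI impI)
    fix \<rho> assume \<rho>: "0 < \<rho>" "\<rho> < min r (e / K)"
    have "K * \<rho>\<^sup>2 = (K * \<rho>) * \<rho>" by (simp add: power2_eq_square)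
    also have "\<dots> \<le> e * \<rho>" using \<rho> K by (intro mult_right_mono) (auto simp: field_simps)
    finally show "\<bar>((SUP y\<in>ball x \<rho>. \<phi> y) - \<phi> x) - norm q * \<rho>\<bar> \<le> e * \<rho>"
      using K(3)[of \<rho>] \<rho> by simp
  qed (use K e in auto)
qed

text \<open>At a critical point no direction is distinguished and the midrange depends on the extreme values of
the quadratic form, so the previous expansion breaks down. Its order \<open>r\<^sup>2\<close> persists, and this is
enough there because large \<open>c\<close> damps the mean operator.\<close>

lemma mean_op_quadratic_bound:
  fixes \<phi> :: "'a::euclidean_space \<Rightarrow> real"
  assumes p: "p > 2" and J: "jet2 \<phi> x q X" and R: "R > 0" and cont: "continuous_on (ball x R) \<phi>"
  shows "\<exists>C. \<forall>\<^sub>F r in at_right 0. \<bar>mean_op p r \<phi> x - \<phi> x\<bar> \<le> C * r\<^sup>2"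
proof (cases "q = 0")
  case False
  have "\<forall>\<^sub>F r in at_right 0. \<bar>mean_op p r \<phi> x - \<phi> x\<bar> \<le> (1 + \<bar>normalized_plap p q X\<bar>) * r\<^sup>2"
    using mean_op_nonzero_gradient[OF p J False R cont zero_less_one]
  proof eventually_elim
    case (elim r)
    have "(1 + \<bar>normalized_plap p q X\<bar>) * r\<^sup>2 = 1 * r\<^sup>2 + \<bar>normalized_plap p q X * r\<^sup>2\<bar>"
      by (simp add: abs_mult distrib_right)
    then show ?case using elim by linarith
  qed
  then show ?thesis by blast
next
  case True
  define d where "d = real DIM('a)"
  define \<gamma> where "\<gamma> = gamma_const p DIM('a)"
  have d: "d > 0" by (simp add: d_def)
  have g: "\<gamma> > 0" "\<And>r. (\<gamma> * r)\<^sup>2 = 2 * (p + d) * r\<^sup>2"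
    using gamma_const_props[OF p] by (auto simp: \<gamma>_def d_def)
  define \<beta> where "\<beta> = beta_const p DIM('a)"
  have \<beta>: "0 \<le> \<beta>" "\<beta> \<le> 1"
    using p d by (auto simp: \<beta>_def beta_const_def d_def[symmetric] field_simps)
  obtain K1 r1 where K1: "K1 > 0" "r1 > 0"
    "\<And>\<rho>. 0 < \<rho> \<Longrightarrow> \<rho> < r1 \<Longrightarrow> 0 \<le> (SUP y\<in>ball x \<rho>. \<phi> y) - \<phi> x"
    "\<And>\<rho>. 0 < \<rho> \<Longrightarrow> \<rho> < r1 \<Longrightarrow> (SUP y\<in>ball x \<rho>. \<phi> y) - \<phi> x \<le> K1 * \<rho>\<^sup>2"
    using jet2_zero_gradient_bound[OF J[unfolded True]] by blast
  have "jet2 (\<lambda>y. - \<phi> y) x 0 (\<lambda>h. - X h)" using jet2_uminus[OF J] True by simp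
  then obtain K2 r2 where K2: "K2 > 0" "r2 > 0"
    "\<And>\<rho>. 0 < \<rho> \<Longrightarrow> \<rho> < r2 \<Longrightarrow> 0 \<le> (SUP y\<in>ball x \<rho>. - \<phi> y) - - \<phi> x"
    "\<And>\<rho>. 0 < \<rho> \<Longrightarrow> \<rho> < r2 \<Longrightarrow> (SUP y\<in>ball x \<rho>. - \<phi> y) - - \<phi> x \<le> K2 * \<rho>\<^sup>2"
    using jet2_zero_gradient_bound by blast
  define K where "K = K1 + K2 + 1 + \<bar>1 / (2 * (d + 2)) * trace_op X\<bar>"
  have Kp: "K > 0" unfolding K_def using K1(1) K2(1) by linarith
  have "\<forall>\<^sub>F \<rho> in at_right 0. \<rho> < min r1 r2 \<and> 0 < \<rho>"
    unfolding eventually_at_right_field using K1 K2 by (intro exI[of _ "min r1 r2"]) auto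
  from eventually_at_right_scale[OF g(1) this]
    eventually_at_right_scale[OF g(1) jet2_average[OF J R cont zero_less_one]]
  have "\<forall>\<^sub>F r in at_right 0. \<bar>mean_op p r \<phi> x - \<phi> x\<bar> \<le> (K * (2 * (p + d))) * r\<^sup>2"
  proof eventually_elim
    case (elim r)
    let ?B = "ball x (\<gamma> * r)"
    define a where "a = (1/2) * (SUP y\<in>?B. \<phi> y) + (1/2) * (INF y\<in>?B. \<phi> y)"
    define b where "b = 1 / measure lborel ?B * (LINT y:?B|lborel. \<phi> y)"
    have "mean_op p r \<phi> x = \<beta> * a + (1 - \<beta>) * b"
      by (simp add: mean_op_def Let_def a_def b_def \<beta>_def \<gamma>_def)
    then have "mean_op p r \<phi> x - \<phi> x = \<beta> * (a - \<phi> x) + (1 - \<beta>) * (b - \<phi> x)"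
      by (simp add: algebra_simps)
    moreover have "\<bar>a - \<phi> x\<bar> \<le> K * (\<gamma> * r)\<^sup>2"
    proof -
      have "\<bar>a - \<phi> x\<bar> \<le> K1 * (\<gamma> * r)\<^sup>2 + K2 * (\<gamma> * r)\<^sup>2"
        using elim K1(3,4)[of "\<gamma> * r"] K2(3,4)[of "\<gamma> * r"]
        unfolding a_def INF_eq_uminus_SUP by (simp add: abs_le_iff)
      also have "\<dots> \<le> K * (\<gamma> * r)\<^sup>2"
        by (simp only: distrib_right[symmetric]) (intro mult_right_mono, auto simp: K_def)
      finally show ?thesis .
    qed
    moreover have "\<bar>b - \<phi> x\<bar> \<le> K * (\<gamma> * r)\<^sup>2"
    proof -
      define T where "T = 1 / (2 * (d + 2)) * trace_op X"
      have "\<bar>b - (\<phi> x + (\<gamma> * r)\<^sup>2 * T)\<bar> \<le> 1 * (\<gamma> * r)\<^sup>2"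
        using elim by (simp add: b_def d_def T_def)
      moreover have "(1 + \<bar>T\<bar>) * (\<gamma> * r)\<^sup>2 = 1 * (\<gamma> * r)\<^sup>2 + \<bar>(\<gamma> * r)\<^sup>2 * T\<bar>"
        by (simp add: abs_mult algebra_simps)
      ultimately have "\<bar>b - \<phi> x\<bar> \<le> (1 + \<bar>T\<bar>) * (\<gamma> * r)\<^sup>2"
        by linarith
      also have "\<dots> \<le> K * (\<gamma> * r)\<^sup>2"
        using K1(1) K2(1) by (intro mult_right_mono) (auto simp: K_def T_def)
      finally show ?thesis .
    qed
    ultimately have "\<bar>mean_op p r \<phi> x - \<phi> x\<bar> \<le> \<beta> * (K * (\<gamma> * r)\<^sup>2) + (1 - \<beta>) * (K * (\<gamma> * r)\<^sup>2)"
      using \<beta> by (auto simp: abs_mult intro!: order_trans[OF abs_triangle_ineq] add_mono mult_left_mono)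
    also have "\<dots> = K * (\<gamma> * r)\<^sup>2" by (simp add: algebra_simps)
    finally show ?case unfolding g by simp
  qed
  then show ?thesis by blast
qed

section \<open>The infimum over the scale parameter\<close>

lemma powr_tendsto_0_at_right:
  assumes "(k::real) > 0"
  shows "((\<lambda>\<epsilon>. \<epsilon> powr k) \<longlongrightarrow> 0) (at_right 0)"
  using assms by (intro tendsto_zero_powrI[where b = k] tendsto_const)
    (auto simp: eventually_at_right_less tendsto_ident_at eventually_at_right_field intro: exI[of _ 1])

text \<open>The bounds on \<open>c\<close> are chosen so that, for \<open>c\<close> in the range, the radii \<open>\<epsilon>\<^sup>2 c powr (1 - \<alpha>)\<close> and
\<open>\<epsilon> c powr (- \<alpha> / 2)\<close> tend to \<open>0\<close> uniformly (\<open>admissible_radii\<close>), while every fixed \<open>c > 0\<close> is eventually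
in the range (\<open>eventually_admissible\<close>).\<close>

definition scale_range :: "real \<Rightarrow> (real \<Rightarrow> real) \<Rightarrow> (real \<Rightarrow> real) \<Rightarrow> bool" where
  "scale_range \<alpha> m M \<longleftrightarrow>
     (\<forall>\<epsilon>>0. m \<epsilon> = \<epsilon> powr (2 / (2 + \<alpha>)) \<and> M \<epsilon> = \<epsilon> powr (- 2 / (2 - \<alpha>)))"

lemma scale_rangeD:
  assumes "scale_range \<alpha> m M" "\<epsilon> > 0"
  shows "m \<epsilon> = \<epsilon> powr (2 / (2 + \<alpha>))" "M \<epsilon> = \<epsilon> powr (- 2 / (2 - \<alpha>))"
  using assms by (auto simp: scale_range_def)

lemma admissible_radii:
  fixes \<alpha> \<delta> :: real
  assumes \<alpha>: "0 < \<alpha>" "\<alpha> < 1" and \<delta>: "\<delta> > 0"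
    and mM: "scale_range \<alpha> m M"
  shows "\<forall>\<^sub>F \<epsilon> in at_right 0. \<forall>c\<in>{m \<epsilon>..M \<epsilon>}. 0 < c \<and>
     0 < \<epsilon>\<^sup>2 * c powr (1 - \<alpha>) \<and> \<epsilon>\<^sup>2 * c powr (1 - \<alpha>) < \<delta> \<and>
     0 < \<epsilon> * c powr (- \<alpha> / 2) \<and> \<epsilon> * c powr (- \<alpha> / 2) < \<delta>"
proof -
  have "((\<lambda>\<epsilon>. \<epsilon> powr (2 / (2 - \<alpha>))) \<longlongrightarrow> 0) (at_right 0)" "((\<lambda>\<epsilon>. \<epsilon> powr (2 / (2 + \<alpha>))) \<longlongrightarrow> 0) (at_right 0)"
    using \<alpha> by (auto intro!: powr_tendsto_0_at_right)
  from order_tendstoD(2)[OF this(1) \<delta>] order_tendstoD(2)[OF this(2) \<delta>]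
  have ev: "\<forall>\<^sub>F \<epsilon> in at_right 0. \<epsilon> powr (2 / (2 - \<alpha>)) < \<delta>" "\<forall>\<^sub>F \<epsilon> in at_right 0. \<epsilon> powr (2 / (2 + \<alpha>)) < \<delta>" .
  show ?thesis
    using ev eventually_at_right_less[of "0::real"]
  proof (eventually_elim, intro ballI)
    fix \<epsilon> c :: real
    assume small: "\<epsilon> powr (2 / (2 - \<alpha>)) < \<delta>" "\<epsilon> powr (2 / (2 + \<alpha>)) < \<delta>" and \<epsilon>: "0 < \<epsilon>"
      and c: "c \<in> {m \<epsilon>..M \<epsilon>}"
    have c0: "c > 0" using c scale_rangeD(1)[OF mM \<epsilon>] \<epsilon> by (auto intro: less_le_trans[of 0 "m \<epsilon>"])
    have "\<epsilon>\<^sup>2 * c powr (1 - \<alpha>) \<le> \<epsilon>\<^sup>2 * (\<epsilon> powr (- 2 / (2 - \<alpha>))) powr (1 - \<alpha>)"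
      using c c0 scale_rangeD(2)[OF mM \<epsilon>] \<alpha> by (intro mult_left_mono powr_mono2) auto
    also have "\<dots> = \<epsilon> powr (2 + (- 2 / (2 - \<alpha>)) * (1 - \<alpha>))"
      using \<epsilon> unfolding powr_powr powr_add by simp
    also have "2 + (- 2 / (2 - \<alpha>)) * (1 - \<alpha>) = 2 / (2 - \<alpha>)"
      using \<alpha> by (simp add: field_simps)
    finally have 1: "\<epsilon>\<^sup>2 * c powr (1 - \<alpha>) < \<delta>" using small by simp
    have "\<epsilon> * c powr (- \<alpha> / 2) \<le> \<epsilon> * (\<epsilon> powr (2 / (2 + \<alpha>))) powr (- \<alpha> / 2)"
      using c c0 scale_rangeD(1)[OF mM \<epsilon>] \<alpha> \<epsilon> by (intro mult_left_mono powr_mono2') auto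
    also have "\<dots> = \<epsilon> powr (1 + (2 / (2 + \<alpha>)) * (- \<alpha> / 2))"
      using \<epsilon> unfolding powr_powr powr_add by simp
    also have "1 + (2 / (2 + \<alpha>)) * (- \<alpha> / 2) = 2 / (2 + \<alpha>)"
      using \<alpha> by (simp add: field_simps)
    finally have 2: "\<epsilon> * c powr (- \<alpha> / 2) < \<delta>" using small by simp
    show "0 < c \<and> 0 < \<epsilon>\<^sup>2 * c powr (1 - \<alpha>) \<and> \<epsilon>\<^sup>2 * c powr (1 - \<alpha>) < \<delta> \<and>
       0 < \<epsilon> * c powr (- \<alpha> / 2) \<and> \<epsilon> * c powr (- \<alpha> / 2) < \<delta>"
      using 1 2 c0 \<epsilon> by simp
  qed
qed

lemma eventually_admissible:
  fixes \<alpha> c :: real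
  assumes \<alpha>: "0 < \<alpha>" "\<alpha> < 1" and c: "c > 0"
    and mM: "scale_range \<alpha> m M"
  shows "\<forall>\<^sub>F \<epsilon> in at_right 0. c \<in> {m \<epsilon>..M \<epsilon>}"
proof -
  have t: "((\<lambda>\<epsilon>. \<epsilon> powr (2 / (2 - \<alpha>))) \<longlongrightarrow> 0) (at_right 0)" "((\<lambda>\<epsilon>. \<epsilon> powr (2 / (2 + \<alpha>))) \<longlongrightarrow> 0) (at_right 0)"
    using \<alpha> by (auto intro!: powr_tendsto_0_at_right)
  have "1 / c > 0" using c by simp
  from order_tendstoD(2)[OF t(1) this] order_tendstoD(2)[OF t(2) c] eventually_at_right_less[of "0::real"]
  show ?thesis
  proof eventually_elim
    case (elim \<epsilon>)
    have "M \<epsilon> = 1 / \<epsilon> powr (2 / (2 - \<alpha>))"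
      using elim by (simp add: scale_rangeD[OF mM] powr_minus_divide)
    moreover have "c \<le> 1 / \<epsilon> powr (2 / (2 - \<alpha>))" using elim c by (simp add: field_simps)
    ultimately have "c \<le> M \<epsilon>" by simp
    then show ?case using elim by (simp add: scale_rangeD[OF mM])
  qed
qed

text \<open>Here \<open>s\<close> and \<open>\<mu>\<close> stand for the increments of the supremum and of the mean operator. The value of the
integrand at one fixed \<open>c\<close> bounds the infimum; the hypotheses on other scales ensure that the set is
bounded below, without which the infimum would be meaningless.\<close>

lemma INF_upper_asymptotics:
  fixes \<alpha> g l c B :: real
  assumes \<alpha>: "0 < \<alpha>" "\<alpha> < 1"
    and mM: "scale_range \<alpha> m M"
    and g: "g \<ge> 0" and s: "\<And>e. e > 0 \<Longrightarrow> \<forall>\<^sub>F \<rho> in at_right 0. \<bar>s \<rho> - g * \<rho>\<bar> \<le> e * \<rho>"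
    and \<mu>: "\<forall>\<^sub>F r in at_right 0. \<bar>\<mu> r\<bar> \<le> C * r\<^sup>2"
    and l: "\<And>e. e > 0 \<Longrightarrow> \<forall>\<^sub>F r in at_right 0. \<mu> r \<le> (l + e) * r\<^sup>2"
    and c: "c > 0" and B: "\<alpha> * (c powr (1 - \<alpha>) * g) + (1 - \<alpha>) * (c powr (- \<alpha>) * l) < B"
  shows "\<forall>\<^sub>F \<epsilon> in at_right 0.
    (INF c\<in>{m \<epsilon>..M \<epsilon>}. a + (\<alpha> * s (\<epsilon>\<^sup>2 * c powr (1 - \<alpha>)) + (1 - \<alpha>) * \<mu> (\<epsilon> * c powr (- \<alpha> / 2))))
      < a + B * \<epsilon>\<^sup>2"
proof -
  define F where "F \<epsilon> c = \<alpha> * s (\<epsilon>\<^sup>2 * c powr (1 - \<alpha>)) + (1 - \<alpha>) * \<mu> (\<epsilon> * c powr (- \<alpha> / 2))" for \<epsilon> c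
  define k where "k = \<alpha> * c powr (1 - \<alpha>) + (1 - \<alpha>) * c powr (- \<alpha>)"
  have k: "k > 0" using \<alpha> c by (simp add: k_def add_pos_pos)
  define v where "v = \<alpha> * (c powr (1 - \<alpha>) * g) + (1 - \<alpha>) * (c powr (- \<alpha>) * l)"
  \<comment> \<open>Errors \<open>e\<close> in both expansions change the value by \<open>e * k\<close>, half of the available gap.\<close>
  define e where "e = (B - v) / (2 * k)"
  have e: "e > 0" using B k by (simp add: e_def v_def)
  have "\<forall>\<^sub>F \<rho> in at_right 0. \<rho> < (1::real) \<and> \<bar>s \<rho> - g * \<rho>\<bar> \<le> e * \<rho> \<and> \<bar>s \<rho> - g * \<rho>\<bar> \<le> 1 * \<rho> \<and>
      \<bar>\<mu> \<rho>\<bar> \<le> C * \<rho>\<^sup>2 \<and> \<mu> \<rho> \<le> (l + e) * \<rho>\<^sup>2"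
    by (intro eventually_conj s[OF e] s[OF zero_less_one] \<mu> l[OF e])
       (auto simp: eventually_at_right_field intro!: exI[of _ 1])
  then obtain \<delta> where \<delta>: "\<delta> > 0" and d: "\<And>\<rho>. 0 < \<rho> \<Longrightarrow> \<rho> < \<delta> \<Longrightarrow> \<rho> < 1 \<and> \<bar>s \<rho> - g * \<rho>\<bar> \<le> e * \<rho> \<and>
      \<bar>s \<rho> - g * \<rho>\<bar> \<le> 1 * \<rho> \<and> \<bar>\<mu> \<rho>\<bar> \<le> C * \<rho>\<^sup>2 \<and> \<mu> \<rho> \<le> (l + e) * \<rho>\<^sup>2"
    unfolding eventually_at_right_field by auto
  show ?thesis
    using admissible_radii[OF \<alpha> \<delta> mM] eventually_admissible[OF \<alpha> c mM] eventually_at_right_less[of "0::real"]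
  proof eventually_elim
    case (elim \<epsilon>)
    have low: "- 1 - \<bar>C\<bar> \<le> F \<epsilon> c'" if "c' \<in> {m \<epsilon>..M \<epsilon>}" for c'
    proof -
      define \<rho> r where "\<rho> = \<epsilon>\<^sup>2 * c' powr (1 - \<alpha>)" and "r = \<epsilon> * c' powr (- \<alpha> / 2)"
      have rr: "0 < \<rho>" "\<rho> < \<delta>" "0 < r" "r < \<delta>" using elim that by (auto simp: \<rho>_def r_def)
      have "0 \<le> g * \<rho>" using g rr by simp
      then have 1: "- 1 \<le> s \<rho>" using d[OF rr(1,2)] by (simp add: abs_le_iff)
      have "C * r\<^sup>2 \<le> \<bar>C\<bar> * 1"
        using d[OF rr(3,4)] rr(3) by (intro mult_mono power_le_one) auto
      then have 2: "- \<bar>C\<bar> \<le> \<mu> r" using d[OF rr(3,4)] by (simp add: abs_le_iff)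
      have "\<alpha> * - 1 + (1 - \<alpha>) * - \<bar>C\<bar> \<le> F \<epsilon> c'"
        unfolding F_def \<rho>_def[symmetric] r_def[symmetric]
        using 1 2 \<alpha> by (intro add_mono mult_left_mono) auto
      moreover have "(1 - \<alpha>) * \<bar>C\<bar> \<le> 1 * \<bar>C\<bar>" using \<alpha> by (intro mult_right_mono) auto
      ultimately show ?thesis using \<alpha> by simp
    qed
    have "(INF c\<in>{m \<epsilon>..M \<epsilon>}. a + F \<epsilon> c) \<le> a + F \<epsilon> c"
      using elim low by (intro cINF_lower bdd_belowI2[where m = "a + (- 1 - \<bar>C\<bar>)"] add_left_mono) auto
    also have "F \<epsilon> c \<le> (v + e * k) * \<epsilon>\<^sup>2"
    proof -
      define \<rho> r where "\<rho> = \<epsilon>\<^sup>2 * c powr (1 - \<alpha>)" and "r = \<epsilon> * c powr (- \<alpha> / 2)"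
      have rr: "0 < \<rho>" "\<rho> < \<delta>" "0 < r" "r < \<delta>" using elim by (auto simp: \<rho>_def r_def)
      have r2: "r\<^sup>2 = \<epsilon>\<^sup>2 * c powr (- \<alpha>)"
        using c by (simp add: r_def power_mult_distrib powr_power)
      have "F \<epsilon> c \<le> \<alpha> * (g * \<rho> + e * \<rho>) + (1 - \<alpha>) * ((l + e) * r\<^sup>2)"
        unfolding F_def \<rho>_def[symmetric] r_def[symmetric]
        using d[OF rr(1,2)] d[OF rr(3,4)] \<alpha> by (intro add_mono mult_left_mono) (auto simp: abs_le_iff)
      also have "\<dots> = (v + e * k) * \<epsilon>\<^sup>2"
        unfolding r2 by (simp add: \<rho>_def v_def k_def algebra_simps)
      finally show ?thesis .
    qed
    also have "(v + e * k) * \<epsilon>\<^sup>2 < B * \<epsilon>\<^sup>2"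
    proof -
      have "e * k = (B - v) / 2" using k by (simp add: e_def)
      then have "v + e * k < B" using B by (simp add: v_def[symmetric])
      then show ?thesis using elim by simp
    qed
    finally show ?case by (simp add: F_def)
  qed
qed

text \<open>For every \<open>c\<close>, Young's inequality with exponents \<open>\<alpha>\<close> and \<open>1 - \<alpha>\<close> bounds the two terms from below by
a product in which the powers of \<open>c\<close> cancel.\<close>

lemma INF_lower_asymptotics:
  fixes \<alpha> g l B :: real
  assumes \<alpha>: "0 < \<alpha>" "\<alpha> < 1"
    and mM: "scale_range \<alpha> m M"
    and g: "g > 0" and s: "\<And>e. e > 0 \<Longrightarrow> \<forall>\<^sub>F \<rho> in at_right 0. \<bar>s \<rho> - g * \<rho>\<bar> \<le> e * \<rho>"
    and l0: "l > 0" and l: "\<And>e. e > 0 \<Longrightarrow> \<forall>\<^sub>F r in at_right 0. (l - e) * r\<^sup>2 \<le> \<mu> r"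
    and B: "B < g powr \<alpha> * l powr (1 - \<alpha>)"
  shows "\<forall>\<^sub>F \<epsilon> in at_right 0. a + B * \<epsilon>\<^sup>2 \<le>
    (INF c\<in>{m \<epsilon>..M \<epsilon>}. a + (\<alpha> * s (\<epsilon>\<^sup>2 * c powr (1 - \<alpha>)) + (1 - \<alpha>) * \<mu> (\<epsilon> * c powr (- \<alpha> / 2))))"
proof -
  have "((\<lambda>e. (g - e) powr \<alpha> * (l - e) powr (1 - \<alpha>)) \<longlongrightarrow> (g - 0) powr \<alpha> * (l - 0) powr (1 - \<alpha>)) (at_right 0)"
    using g l0 by (intro tendsto_intros) auto
  then have "\<forall>\<^sub>F e in at_right 0. B < (g - e) powr \<alpha> * (l - e) powr (1 - \<alpha>)"
    using B by (intro order_tendstoD(1)) auto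
  then obtain b where b: "b > 0" "\<And>e. 0 < e \<Longrightarrow> e < b \<Longrightarrow> B < (g - e) powr \<alpha> * (l - e) powr (1 - \<alpha>)"
    unfolding eventually_at_right_field by auto
  define e where "e = min (b / 2) (min (g / 2) (l / 2))"
  have e: "e > 0" "e < g" "e < l" "e < b" using b g l0 by (auto simp: e_def)
  have eB: "B < (g - e) powr \<alpha> * (l - e) powr (1 - \<alpha>)" using b e by simp
  have "\<forall>\<^sub>F \<rho> in at_right 0. \<bar>s \<rho> - g * \<rho>\<bar> \<le> e * \<rho> \<and> (l - e) * \<rho>\<^sup>2 \<le> \<mu> \<rho>"
    by (intro eventually_conj s[OF e(1)] l[OF e(1)])
  then obtain \<delta> where \<delta>: "\<delta> > 0"
    and d: "\<And>\<rho>. 0 < \<rho> \<Longrightarrow> \<rho> < \<delta> \<Longrightarrow> \<bar>s \<rho> - g * \<rho>\<bar> \<le> e * \<rho> \<and> (l - e) * \<rho>\<^sup>2 \<le> \<mu> \<rho>"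
    unfolding eventually_at_right_field by auto
  show ?thesis
    using admissible_radii[OF \<alpha> \<delta> mM] eventually_admissible[OF \<alpha> zero_less_one mM]
      eventually_at_right_less[of "0::real"]
  proof eventually_elim
    case (elim \<epsilon>)
    show ?case
    proof (rule cINF_greatest)
      show "{m \<epsilon>..M \<epsilon>} \<noteq> {}" using elim by auto
      fix c assume cm: "c \<in> {m \<epsilon>..M \<epsilon>}"
      define \<rho> r where "\<rho> = \<epsilon>\<^sup>2 * c powr (1 - \<alpha>)" and "r = \<epsilon> * c powr (- \<alpha> / 2)"
      have c: "c > 0" and rr: "0 < \<rho>" "\<rho> < \<delta>" "0 < r" "r < \<delta>"
        using elim cm by (auto simp: \<rho>_def r_def)
      have r2: "r\<^sup>2 = \<epsilon>\<^sup>2 * c powr (- \<alpha>)"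
        using c by (simp add: r_def power_mult_distrib powr_power)
      define P Q where "P = c powr (1 - \<alpha>) * (g - e)" and "Q = c powr (- \<alpha>) * (l - e)"
      have PQ: "P > 0" "Q > 0" using c e by (auto simp: P_def Q_def)
      have "P powr \<alpha> * Q powr (1 - \<alpha>)
          = (c powr ((1 - \<alpha>) * \<alpha>) * c powr (- \<alpha> * (1 - \<alpha>))) * ((g - e) powr \<alpha> * (l - e) powr (1 - \<alpha>))"
        using e by (simp add: P_def Q_def powr_mult powr_powr)
      also have "c powr ((1 - \<alpha>) * \<alpha>) * c powr (- \<alpha> * (1 - \<alpha>)) = 1"
        using c by (simp add: powr_add[symmetric] algebra_simps)
      finally have "B \<le> P powr \<alpha> * Q powr (1 - \<alpha>)" using eB by simp
      also have "\<dots> \<le> \<alpha> * P + (1 - \<alpha>) * Q"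
        using \<alpha> PQ by (intro Youngs_inequality_0) auto
      finally have "B * \<epsilon>\<^sup>2 \<le> (\<alpha> * P + (1 - \<alpha>) * Q) * \<epsilon>\<^sup>2"
        by (intro mult_right_mono) auto
      also have "\<dots> = \<alpha> * (g * \<rho> - e * \<rho>) + (1 - \<alpha>) * ((l - e) * r\<^sup>2)"
        unfolding r2 by (simp add: P_def Q_def \<rho>_def algebra_simps)
      also have "\<dots> \<le> \<alpha> * s \<rho> + (1 - \<alpha>) * \<mu> r"
        using d[OF rr(1,2)] d[OF rr(3,4)] \<alpha> by (intro add_mono mult_left_mono) (auto simp: abs_le_iff)
      finally show "a + B * \<epsilon>\<^sup>2 \<le> a + (\<alpha> * s (\<epsilon>\<^sup>2 * c powr (1 - \<alpha>)) + (1 - \<alpha>) * \<mu> (\<epsilon> * c powr (- \<alpha> / 2)))"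
        by (simp add: \<rho>_def r_def)
    qed
  qed
qed

lemma alpha_const_props:
  assumes "p > 2"
  shows "0 < alpha_const p" "alpha_const p < 1" "1 - alpha_const p = 1 / (p - 1)"
  using assms by (auto simp: alpha_const_def field_simps)

text \<open>Subtracting \<open>\<phi> x\<close> from both terms is harmless because the weights \<open>\<alpha>\<close> and \<open>1 - \<alpha>\<close> add up to \<open>1\<close>.\<close>

lemma A_plus_centered:
  "A_plus p m M \<epsilon> \<phi> x = (INF c\<in>{m \<epsilon>..M \<epsilon>}. \<phi> x +
     (alpha_const p * ((SUP y\<in>ball x (\<epsilon>\<^sup>2 * c powr (1 - alpha_const p)). \<phi> y) - \<phi> x) +
      (1 - alpha_const p) * (mean_op p (\<epsilon> * c powr (- alpha_const p / 2)) \<phi> x - \<phi> x)))"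
  unfolding A_plus_def Let_def by (intro INF_cong refl) (simp add: algebra_simps)

lemma C2_at_continuous_on:
  assumes "C2_at \<phi> x R X"
  shows "continuous_on (ball x R) \<phi>"
  using assms by (auto simp: C2_at_def intro!: continuous_at_imp_continuous_on differentiable_imp_continuous_within)

lemma A_plus_upper_nonzero_gradient:
  fixes \<phi> :: "'a::euclidean_space \<Rightarrow> real"
  assumes p: "p > 2"
    and mM: "scale_range (alpha_const p) m M"
    and C: "C2_at \<phi> x R X" and q: "grad \<phi> x \<noteq> 0" and c: "c > 0"
    and B: "alpha_const p * (c powr (1 - alpha_const p) * norm (grad \<phi> x))
       + (1 - alpha_const p) * (c powr (- alpha_const p) * normalized_plap p (grad \<phi> x) X) < B"
  shows "\<forall>\<^sub>F \<epsilon> in at_right 0. A_plus p m M \<epsilon> \<phi> x < \<phi> x + B * \<epsilon>\<^sup>2"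
proof -
  have R: "R > 0" using C by (simp add: C2_at_def)
  note J = C2_at_jet2[OF C] and cont = C2_at_continuous_on[OF C]
  obtain K where K: "\<forall>\<^sub>F r in at_right 0. \<bar>mean_op p r \<phi> x - \<phi> x\<bar> \<le> K * r\<^sup>2"
    using mean_op_quadratic_bound[OF p J R cont] by blast
  show ?thesis
    unfolding A_plus_centered
  proof (rule INF_upper_asymptotics[OF alpha_const_props(1,2)[OF p] mM norm_ge_zero
        SUP_ball_first_order[OF J] K _ c B])
    fix e :: real assume "e > 0"
    from mean_op_nonzero_gradient[OF p J q R cont this]
    show "\<forall>\<^sub>F r in at_right 0. mean_op p r \<phi> x - \<phi> x \<le> (normalized_plap p (grad \<phi> x) X + e) * r\<^sup>2"
      by eventually_elim (simp add: abs_le_iff algebra_simps)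
  qed
qed

text \<open>With vanishing gradient the supremum contributes \<open>o(\<epsilon>\<^sup>2)\<close> and the mean operator at most
\<open>K c powr (- \<alpha>) \<epsilon>\<^sup>2\<close>, which is small for large \<open>c\<close>.\<close>

lemma A_plus_upper_zero_gradient:
  fixes \<phi> :: "'a::euclidean_space \<Rightarrow> real"
  assumes p: "p > 2"
    and mM: "scale_range (alpha_const p) m M"
    and C: "C2_at \<phi> x R X" and q: "grad \<phi> x = 0" and B: "B > 0"
  shows "\<forall>\<^sub>F \<epsilon> in at_right 0. A_plus p m M \<epsilon> \<phi> x < \<phi> x + B * \<epsilon>\<^sup>2"
proof -
  define \<alpha> where "\<alpha> = alpha_const p"
  have \<alpha>: "0 < \<alpha>" "\<alpha> < 1" using alpha_const_props[OF p] by (auto simp: \<alpha>_def)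
  have R: "R > 0" using C by (simp add: C2_at_def)
  note J = C2_at_jet2[OF C] and cont = C2_at_continuous_on[OF C]
  obtain K where K: "\<forall>\<^sub>F r in at_right 0. \<bar>mean_op p r \<phi> x - \<phi> x\<bar> \<le> K * r\<^sup>2"
    using mean_op_quadratic_bound[OF p J R cont] by blast
  define k where "k = \<bar>K\<bar> + 1"
  have k: "k > 0" "K \<le> k" by (auto simp: k_def)
  define t where "t = B / (2 * k)"
  define c where "c = t powr (- 1 / \<alpha>)"
  have t: "t > 0" using B k by (simp add: t_def)
  then have c: "c > 0" by (simp add: c_def)
  have ct: "c powr (- \<alpha>) = t" using t \<alpha> by (simp add: c_def powr_powr)
  have "(1 - \<alpha>) * (t * K) \<le> 1 * (t * k)"
    using \<alpha> t k by (intro order_trans[OF mult_left_mono mult_right_mono] mult_left_mono) auto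
  also have "\<dots> = B / 2" using k by (simp add: t_def)
  finally have B': "\<alpha> * (c powr (1 - \<alpha>) * norm (grad \<phi> x)) + (1 - \<alpha>) * (c powr (- \<alpha>) * K) < B"
    using B q by (simp add: ct)
  show ?thesis
    unfolding A_plus_centered \<alpha>_def[symmetric]
  proof (rule INF_upper_asymptotics[OF \<alpha> mM[folded \<alpha>_def] norm_ge_zero
        SUP_ball_first_order[OF J] K _ c B'])
    fix e :: real assume "e > 0"
    then have "K * r\<^sup>2 \<le> (K + e) * r\<^sup>2" for r by (intro mult_right_mono) auto
    with K show "\<forall>\<^sub>F r in at_right 0. mean_op p r \<phi> x - \<phi> x \<le> (K + e) * r\<^sup>2"
      by (auto elim!: eventually_mono simp: abs_le_iff intro: order_trans)
  qed
qed

lemma A_plus_lower: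
  fixes \<phi> :: "'a::euclidean_space \<Rightarrow> real"
  assumes p: "p > 2"
    and mM: "scale_range (alpha_const p) m M"
    and C: "C2_at \<phi> x R X" and q: "grad \<phi> x \<noteq> 0" and L: "normalized_plap p (grad \<phi> x) X > 0"
    and B: "B < norm (grad \<phi> x) powr alpha_const p * normalized_plap p (grad \<phi> x) X powr (1 - alpha_const p)"
  shows "\<forall>\<^sub>F \<epsilon> in at_right 0. \<phi> x + B * \<epsilon>\<^sup>2 \<le> A_plus p m M \<epsilon> \<phi> x"
proof -
  have R: "R > 0" using C by (simp add: C2_at_def)
  note J = C2_at_jet2[OF C] and cont = C2_at_continuous_on[OF C]
  have g: "norm (grad \<phi> x) > 0" using q by simp
  show ?thesis
    unfolding A_plus_centered
  proof (rule INF_lower_asymptotics[OF alpha_const_props(1,2)[OF p] mM g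
        SUP_ball_first_order[OF J] L _ B])
    fix e :: real assume "e > 0"
    from mean_op_nonzero_gradient[OF p J q R cont this]
    show "\<forall>\<^sub>F r in at_right 0. (normalized_plap p (grad \<phi> x) X - e) * r\<^sup>2 \<le> mean_op p r \<phi> x - \<phi> x"
      by eventually_elim (simp add: abs_le_iff algebra_simps)
  qed
qed

lemma p_laplacian_sign:
  assumes p: "p > 2" and C: "C2_at \<phi> x R X"
  shows "grad \<phi> x = 0 \<Longrightarrow> p_laplacian p \<phi> x = 0"
    and "grad \<phi> x \<noteq> 0 \<Longrightarrow> p_laplacian p \<phi> x > 0 \<longleftrightarrow> normalized_plap p (grad \<phi> x) X > 0"
    and "grad \<phi> x \<noteq> 0 \<Longrightarrow> p_laplacian p \<phi> x < 0 \<longleftrightarrow> normalized_plap p (grad \<phi> x) X < 0"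
  using p_laplacian_eq[OF p, of \<phi> X x] C
  by (auto simp: C2_at_def zero_less_mult_iff mult_less_0_iff)

text \<open>The minimal value over \<open>c\<close> of the limiting expression is the signed power of the p-Laplacian:
\<open>\<alpha> = (p - 2) / (p - 1)\<close> and \<open>1 - \<alpha> = 1 / (p - 1)\<close>.\<close>

lemma signed_power_p_laplacian:
  assumes p: "p > 2" and C: "C2_at \<phi> x R X" and pos: "p_laplacian p \<phi> x > 0"
  shows "signed_power p (p_laplacian p \<phi> x)
    = norm (grad \<phi> x) powr alpha_const p * normalized_plap p (grad \<phi> x) X powr (1 - alpha_const p)"
proof -
  have q: "grad \<phi> x \<noteq> 0" using p_laplacian_sign(1)[OF p C] pos by auto
  then have L: "normalized_plap p (grad \<phi> x) X > 0" using p_laplacian_sign(2)[OF p C] pos by auto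
  have "p_laplacian p \<phi> x = norm (grad \<phi> x) powr (p - 2) * normalized_plap p (grad \<phi> x) X"
    using p_laplacian_eq[OF p, of \<phi> X x] C q by (simp add: C2_at_def)
  then show ?thesis
    using pos p L alpha_const_props(3)[OF p]
    by (simp add: signed_power_def powr_mult powr_powr) (simp add: alpha_const_def)
qed

text \<open>If the second-order term is not positive, only the gradient term remains, and a small \<open>c\<close> makes it
smaller than any \<open>B > 0\<close>.\<close>

lemma A_plus_upper_nonpos:
  fixes \<phi> :: "'a::euclidean_space \<Rightarrow> real"
  assumes p: "p > 2"
    and mM: "scale_range (alpha_const p) m M"
    and C: "C2_at \<phi> x R X" and D: "p_laplacian p \<phi> x \<le> 0" and B: "B > 0"
  shows "\<forall>\<^sub>F \<epsilon> in at_right 0. A_plus p m M \<epsilon> \<phi> x < \<phi> x + B * \<epsilon>\<^sup>2"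
proof (cases "grad \<phi> x = 0")
  case True
  then show ?thesis by (rule A_plus_upper_zero_gradient[OF p mM C _ B])
next
  case False
  define \<alpha> where "\<alpha> = alpha_const p"
  have \<alpha>: "0 < \<alpha>" "\<alpha> < 1" using alpha_const_props[OF p] by (auto simp: \<alpha>_def)
  define g where "g = norm (grad \<phi> x)"
  have g: "g > 0" using False by (simp add: g_def)
  have L: "normalized_plap p (grad \<phi> x) X \<le> 0"
    using p_laplacian_sign(2)[OF p C False] D by auto
  define t where "t = B / (2 * g)"
  define c where "c = t powr (1 / (1 - \<alpha>))"
  have t: "t > 0" using B g by (simp add: t_def)
  then have c: "c > 0" by (simp add: c_def)
  have ct: "c powr (1 - \<alpha>) = t" using t \<alpha> by (simp add: c_def powr_powr)
  have "\<alpha> * (t * g) \<le> 1 * (t * g)" using \<alpha> t g by (intro mult_right_mono) auto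
  also have "\<dots> < B" using g B by (simp add: t_def)
  finally have "\<alpha> * (c powr (1 - \<alpha>) * g) < B" by (simp add: ct)
  moreover have "(1 - \<alpha>) * (c powr (- \<alpha>) * normalized_plap p (grad \<phi> x) X) \<le> 0"
    using L \<alpha> by (intro mult_nonneg_nonpos) auto
  ultimately show ?thesis
    by (intro A_plus_upper_nonzero_gradient[OF p mM C False c]) (auto simp: \<alpha>_def g_def)
qed

text \<open>The choice \<open>c = L / \<bar>q\<bar>\<close> gives equality in Young's inequality.\<close>

lemma A_plus_upper_pos:
  fixes \<phi> :: "'a::euclidean_space \<Rightarrow> real"
  assumes p: "p > 2"
    and mM: "scale_range (alpha_const p) m M"
    and C: "C2_at \<phi> x R X" and D: "p_laplacian p \<phi> x > 0" and B: "B > signed_power p (p_laplacian p \<phi> x)"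
  shows "\<forall>\<^sub>F \<epsilon> in at_right 0. A_plus p m M \<epsilon> \<phi> x < \<phi> x + B * \<epsilon>\<^sup>2"
proof -
  have q: "grad \<phi> x \<noteq> 0" using p_laplacian_sign(1)[OF p C] D by auto
  define \<alpha> where "\<alpha> = alpha_const p"
  define g where "g = norm (grad \<phi> x)"
  define L where "L = normalized_plap p (grad \<phi> x) X"
  have g: "g > 0" using q by (simp add: g_def)
  have L: "L > 0" using p_laplacian_sign(2)[OF p C q] D by (auto simp: L_def)
  define c where "c = L / g"
  have c: "c > 0" using L g by (simp add: c_def)
  have 1: "c powr (1 - \<alpha>) * g = g powr \<alpha> * L powr (1 - \<alpha>)"
    using L g by (simp add: c_def powr_divide powr_diff)
  have 2: "c powr (- \<alpha>) * L = g powr \<alpha> * L powr (1 - \<alpha>)"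
    using L g by (simp add: c_def powr_divide powr_diff powr_minus divide_simps)
  have "\<alpha> * (c powr (1 - \<alpha>) * g) + (1 - \<alpha>) * (c powr (- \<alpha>) * L) = g powr \<alpha> * L powr (1 - \<alpha>)"
    unfolding 1 2 by (simp add: algebra_simps)
  also have "\<dots> < B"
    using B signed_power_p_laplacian[OF p C D] by (simp add: g_def L_def \<alpha>_def)
  finally show ?thesis
    by (intro A_plus_upper_nonzero_gradient[OF p mM C q c]) (simp add: \<alpha>_def g_def L_def)
qed

text \<open>A negative second-order term is amplified without bound by \<open>c powr (- \<alpha>)\<close> as \<open>c \<rightarrow> 0\<close>. This
is why the subsolution inequality detects a negative p-Laplacian even where \<open>f\<close> vanishes.\<close>

lemma A_plus_upper_neg:
  fixes \<phi> :: "'a::euclidean_space \<Rightarrow> real"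
  assumes p: "p > 2"
    and mM: "scale_range (alpha_const p) m M"
    and C: "C2_at \<phi> x R X" and D: "p_laplacian p \<phi> x < 0"
  shows "\<forall>\<^sub>F \<epsilon> in at_right 0. A_plus p m M \<epsilon> \<phi> x < \<phi> x + B * \<epsilon>\<^sup>2"
proof -
  have q: "grad \<phi> x \<noteq> 0" using p_laplacian_sign(1)[OF p C] D by auto
  define \<alpha> where "\<alpha> = alpha_const p"
  have \<alpha>: "0 < \<alpha>" "\<alpha> < 1" using alpha_const_props[OF p] by (auto simp: \<alpha>_def)
  define g where "g = norm (grad \<phi> x)"
  define L where "L = normalized_plap p (grad \<phi> x) X"
  have g: "g > 0" using q by (simp add: g_def)
  have L: "L < 0" using p_laplacian_sign(3)[OF p C q] D by (auto simp: L_def)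
  define W where "W = (1 - \<alpha>) * - L"
  have W: "W > 0" unfolding W_def using \<alpha> L by (intro mult_pos_pos) auto
  define T where "T = 1 + (g + \<bar>B\<bar>) / W"
  define c where "c = T powr (- 1 / \<alpha>)"
  have T: "T \<ge> 1" using W g by (simp add: T_def)
  then have c: "c > 0" by (simp add: c_def)
  have ct: "c powr (- \<alpha>) = T" using T \<alpha> by (simp add: c_def powr_powr)
  have c1: "c \<le> 1" using powr_mono[of "- 1 / \<alpha>" 0 T] T \<alpha> by (simp add: c_def)
  have "\<alpha> * (c powr (1 - \<alpha>) * g) \<le> 1 * (1 * g)"
    using \<alpha> c c1 g by (intro mult_mono powr_le1) auto
  moreover have "(1 - \<alpha>) * (T * L) = - (W * T)" by (simp add: W_def)
  moreover have "W * T = W + (g + \<bar>B\<bar>)" using W by (simp add: T_def field_simps)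
  ultimately have "\<alpha> * (c powr (1 - \<alpha>) * g) + (1 - \<alpha>) * (c powr (- \<alpha>) * L) < B"
    unfolding ct using W by linarith
  then show ?thesis
    by (intro A_plus_upper_nonzero_gradient[OF p mM C q c]) (simp add: \<alpha>_def g_def L_def)
qed

lemma A_plus_lower_pos:
  fixes \<phi> :: "'a::euclidean_space \<Rightarrow> real"
  assumes p: "p > 2"
    and mM: "scale_range (alpha_const p) m M"
    and C: "C2_at \<phi> x R X" and D: "p_laplacian p \<phi> x > 0" and B: "B < signed_power p (p_laplacian p \<phi> x)"
  shows "\<forall>\<^sub>F \<epsilon> in at_right 0. \<phi> x + B * \<epsilon>\<^sup>2 \<le> A_plus p m M \<epsilon> \<phi> x"
proof -
  have q: "grad \<phi> x \<noteq> 0" using p_laplacian_sign(1)[OF p C] D by auto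
  then have "normalized_plap p (grad \<phi> x) X > 0" using p_laplacian_sign(2)[OF p C] D by auto
  then show ?thesis
    using B signed_power_p_laplacian[OF p C D] by (intro A_plus_lower[OF p mM C q]) auto
qed

section \<open>Consistency of the mean value operators\<close>

lemma le_o_sq_iff:
  "le_o_sq a (\<lambda>\<epsilon>. \<epsilon>\<^sup>2 * b) \<longleftrightarrow> (\<forall>e>0. \<forall>\<^sub>F \<epsilon> in at_right 0. a \<epsilon> < (b + e) * \<epsilon>\<^sup>2)"
proof -
  have "le_o_sq a (\<lambda>\<epsilon>. \<epsilon>\<^sup>2 * b) \<longleftrightarrow>
      (\<forall>e>0. \<forall>\<^sub>F \<epsilon> in at_right 0. ereal ((a \<epsilon> - \<epsilon>\<^sup>2 * b) / \<epsilon>\<^sup>2) < ereal e)"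
    unfolding le_o_sq_def Limsup_le_iff
  proof (intro iffI allI impI)
    fix y :: ereal
    assume H: "\<forall>e>0. \<forall>\<^sub>F \<epsilon> in at_right 0. ereal ((a \<epsilon> - \<epsilon>\<^sup>2 * b) / \<epsilon>\<^sup>2) < ereal e" and y: "0 < y"
    obtain e where e: "0 < ereal e" "ereal e < y"
      using ereal_dense2[OF y] by (auto simp: zero_ereal_def)
    have "\<forall>\<^sub>F \<epsilon> in at_right 0. ereal ((a \<epsilon> - \<epsilon>\<^sup>2 * b) / \<epsilon>\<^sup>2) < ereal e"
      using H e(1) by simp
    then show "\<forall>\<^sub>F \<epsilon> in at_right 0. ereal ((a \<epsilon> - \<epsilon>\<^sup>2 * b) / \<epsilon>\<^sup>2) < y"
      by (rule eventually_mono) (erule less_trans[OF _ e(2)])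
  next
    fix e :: real
    assume "\<forall>y>0. \<forall>\<^sub>F \<epsilon> in at_right 0. ereal ((a \<epsilon> - \<epsilon>\<^sup>2 * b) / \<epsilon>\<^sup>2) < y" "0 < e"
    then show "\<forall>\<^sub>F \<epsilon> in at_right 0. ereal ((a \<epsilon> - \<epsilon>\<^sup>2 * b) / \<epsilon>\<^sup>2) < ereal e"
      by (simp only: ereal_less(2))
  qed
  also have "\<dots> \<longleftrightarrow> (\<forall>e>0. \<forall>\<^sub>F \<epsilon> in at_right 0. a \<epsilon> < (b + e) * \<epsilon>\<^sup>2)"
  proof -
    have "(\<forall>\<^sub>F \<epsilon> in at_right 0. ereal ((a \<epsilon> - \<epsilon>\<^sup>2 * b) / \<epsilon>\<^sup>2) < ereal e)
        \<longleftrightarrow> (\<forall>\<^sub>F \<epsilon> in at_right 0. a \<epsilon> < (b + e) * \<epsilon>\<^sup>2)" for e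
      by (rule eventually_cong[OF eventually_at_right_less[of "0::real"]]) (simp add: field_simps)
    then show ?thesis by simp
  qed
  finally show ?thesis .
qed

lemma ge_o_sq_iff_le_o_sq:
  "ge_o_sq a (\<lambda>\<epsilon>. \<epsilon>\<^sup>2 * b) \<longleftrightarrow> le_o_sq (\<lambda>\<epsilon>. - a \<epsilon>) (\<lambda>\<epsilon>. \<epsilon>\<^sup>2 * - b)"
proof -
  have "ereal ((- a \<epsilon> - \<epsilon>\<^sup>2 * - b) / \<epsilon>\<^sup>2) = - ereal ((a \<epsilon> - \<epsilon>\<^sup>2 * b) / \<epsilon>\<^sup>2)" for \<epsilon>
    by (simp add: minus_divide_left)
  then show ?thesis
    unfolding le_o_sq_def ge_o_sq_def by (simp only: ereal_Limsup_uminus ereal_uminus_le_0_iff)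
qed

lemma ge_o_sq_iff:
  "ge_o_sq a (\<lambda>\<epsilon>. \<epsilon>\<^sup>2 * b) \<longleftrightarrow> (\<forall>e>0. \<forall>\<^sub>F \<epsilon> in at_right 0. (b - e) * \<epsilon>\<^sup>2 < a \<epsilon>)"
proof -
  have "- a \<epsilon> < (- b + e) * \<epsilon>\<^sup>2 \<longleftrightarrow> (b - e) * \<epsilon>\<^sup>2 < a \<epsilon>" for e \<epsilon>
    by (auto simp: algebra_simps)
  then show ?thesis unfolding ge_o_sq_iff_le_o_sq le_o_sq_iff by simp
qed

lemma eventually_at_right_contradiction:
  fixes P Q :: "real \<Rightarrow> bool"
  assumes "\<forall>\<^sub>F \<epsilon> in at_right 0. P \<epsilon>" "\<forall>\<^sub>F \<epsilon> in at_right 0. Q \<epsilon>" "\<And>\<epsilon>. \<epsilon> > 0 \<Longrightarrow> P \<epsilon> \<Longrightarrow> \<not> Q \<epsilon>"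
  shows False
proof -
  have "\<forall>\<^sub>F \<epsilon> in at_right (0::real). False"
    using assms(1,2) eventually_at_right_less[of "0::real"] by eventually_elim (use assms(3) in auto)
  then show False by (simp add: trivial_limit_at_right_real)
qed

lemma signed_power_uminus: "p > 2 \<Longrightarrow> signed_power p (- \<xi>) = - signed_power p \<xi>"
  by (auto simp: signed_power_def)

lemma signed_power_mono: "p > 2 \<Longrightarrow> 0 \<le> a \<Longrightarrow> a \<le> b \<Longrightarrow> signed_power p a \<le> signed_power p b"
  by (simp add: signed_power_def powr_mono2)

lemma signed_power_strict_mono: "p > 2 \<Longrightarrow> 0 \<le> a \<Longrightarrow> a < b \<Longrightarrow> signed_power p a < signed_power p b"
  by (simp add: signed_power_def powr_less_mono2)

lemma signed_power_zero: "p > 2 \<Longrightarrow> signed_power p 0 = 0"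
  by (simp add: signed_power_def)

text \<open>The signed power is strictly increasing on nonnegative arguments, so comparing the asymptotic value
of \<open>A_plus\<close> with the signed power of \<open>k\<close> amounts to comparing the p-Laplacian with \<open>k\<close>. At \<open>k = 0\<close> a
vanishing p-Laplacian is excluded: the lower bound on \<open>A_plus\<close> is available for positive values only.\<close>

lemma A_plus_consistent:
  fixes \<phi> :: "'a::euclidean_space \<Rightarrow> real"
  assumes p: "p > 2" and mM: "scale_range (alpha_const p) m M"
    and C: "C2_at \<phi> x R X" and k: "k \<ge> 0" and nz: "k = 0 \<Longrightarrow> p_laplacian p \<phi> x \<noteq> 0"
  shows "le_o_sq (\<lambda>\<epsilon>. A_plus p m M \<epsilon> \<phi> x - \<phi> x) (\<lambda>\<epsilon>. \<epsilon>\<^sup>2 * signed_power p k) \<longleftrightarrow> p_laplacian p \<phi> x \<le> k"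
    and "ge_o_sq (\<lambda>\<epsilon>. A_plus p m M \<epsilon> \<phi> x - \<phi> x) (\<lambda>\<epsilon>. \<epsilon>\<^sup>2 * signed_power p k) \<longleftrightarrow> k \<le> p_laplacian p \<phi> x"
proof -
  define D where "D = p_laplacian p \<phi> x"
  define J where "J = signed_power p"
  have J0: "J k \<ge> 0" using signed_power_mono[OF p order_refl k] signed_power_zero[OF p] by (simp add: J_def)
  note U0 = A_plus_upper_nonpos[OF p mM C, folded D_def]
  note U = A_plus_upper_pos[OF p mM C, folded D_def J_def]
  note N = A_plus_upper_neg[OF p mM C, folded D_def]
  note W = A_plus_lower_pos[OF p mM C, folded D_def J_def]
  show "le_o_sq (\<lambda>\<epsilon>. A_plus p m M \<epsilon> \<phi> x - \<phi> x) (\<lambda>\<epsilon>. \<epsilon>\<^sup>2 * signed_power p k) \<longleftrightarrow> p_laplacian p \<phi> x \<le> k"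
    unfolding le_o_sq_iff J_def[symmetric] D_def[symmetric]
  proof (intro iffI allI impI)
    assume le: "D \<le> k"
    fix e :: real assume e: "e > 0"
    have "\<forall>\<^sub>F \<epsilon> in at_right 0. A_plus p m M \<epsilon> \<phi> x < \<phi> x + (J k + e) * \<epsilon>\<^sup>2"
    proof (cases "D \<le> 0")
      case True
      then show ?thesis using J0 e by (intro U0) auto
    next
      case False
      then show ?thesis
        using signed_power_mono[OF p, of D k] le e by (intro U) (auto simp: J_def)
    qed
    then show "\<forall>\<^sub>F \<epsilon> in at_right 0. A_plus p m M \<epsilon> \<phi> x - \<phi> x < (J k + e) * \<epsilon>\<^sup>2"
      by (auto elim: eventually_mono)
  next
    assume H: "\<forall>e>0. \<forall>\<^sub>F \<epsilon> in at_right 0. A_plus p m M \<epsilon> \<phi> x - \<phi> x < (J k + e) * \<epsilon>\<^sup>2"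
    show "D \<le> k"
    proof (rule ccontr)
      assume "\<not> D \<le> k"
      then have D: "D > 0" "J k < J D"
        using k signed_power_strict_mono[OF p k, of D] by (auto simp: J_def)
      define e where "e = (J D - J k) / 2"
      have e: "e > 0" "J k + e < J D" using D(2) by (auto simp: e_def field_simps)
      show False
        by (rule eventually_at_right_contradiction[OF H[rule_format, OF e(1)] W[OF D(1) e(2)]]) simp
    qed
  qed
  show "ge_o_sq (\<lambda>\<epsilon>. A_plus p m M \<epsilon> \<phi> x - \<phi> x) (\<lambda>\<epsilon>. \<epsilon>\<^sup>2 * signed_power p k) \<longleftrightarrow> k \<le> p_laplacian p \<phi> x"
    unfolding ge_o_sq_iff J_def[symmetric] D_def[symmetric]
  proof (intro iffI allI impI)
    assume le: "k \<le> D"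
    fix e :: real assume e: "e > 0"
    have D: "D > 0" using le k nz by (cases "k = 0") (auto simp: D_def)
    have "J k - e / 2 < J D" using signed_power_mono[OF p k le] e by (simp add: J_def)
    from W[OF D this] eventually_at_right_less[of "0::real"]
    show "\<forall>\<^sub>F \<epsilon> in at_right 0. (J k - e) * \<epsilon>\<^sup>2 < A_plus p m M \<epsilon> \<phi> x - \<phi> x"
    proof eventually_elim
      case (elim \<epsilon>)
      have "(J k - e) * \<epsilon>\<^sup>2 < (J k - e / 2) * \<epsilon>\<^sup>2" using elim e by (intro mult_strict_right_mono) auto
      then show ?case using elim by linarith
    qed
  next
    assume H: "\<forall>e>0. \<forall>\<^sub>F \<epsilon> in at_right 0. (J k - e) * \<epsilon>\<^sup>2 < A_plus p m M \<epsilon> \<phi> x - \<phi> x"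
    show "k \<le> D"
    proof (rule ccontr)
      assume "\<not> k \<le> D"
      then have Dk: "D < k" by simp
      have "\<exists>e>0. \<forall>\<^sub>F \<epsilon> in at_right 0. A_plus p m M \<epsilon> \<phi> x < \<phi> x + (J k - e) * \<epsilon>\<^sup>2"
      proof (cases "D < 0")
        case True
        then show ?thesis using N[OF True, of "J k - 1"] by (intro exI[of _ 1]) auto
      next
        case False
        then have lt: "J D < J k" using signed_power_strict_mono[OF p _ Dk] by (simp add: J_def)
        define e where "e = (J k - J D) / 2"
        have e: "e > 0" "J D < J k - e" using lt by (auto simp: e_def field_simps)
        have "\<forall>\<^sub>F \<epsilon> in at_right 0. A_plus p m M \<epsilon> \<phi> x < \<phi> x + (J k - e) * \<epsilon>\<^sup>2"
        proof (cases "D = 0")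
          case True
          then show ?thesis using e(2) signed_power_zero[OF p] by (intro U0) (auto simp: J_def)
        next
          case False
          then show ?thesis using \<open>\<not> D < 0\<close> e(2) by (intro U) auto
        qed
        then show ?thesis using e by blast
      qed
      then obtain e where e: "e > 0"
        and ev: "\<forall>\<^sub>F \<epsilon> in at_right 0. A_plus p m M \<epsilon> \<phi> x < \<phi> x + (J k - e) * \<epsilon>\<^sup>2" by blast
      show False
        by (rule eventually_at_right_contradiction[OF H[rule_format, OF e] ev]) simp
    qed
  qed
qed

lemma mean_op_uminus: "mean_op p r (\<lambda>y. - \<phi> y) x = - mean_op p r \<phi> x"
proof -
  have "(LINT y:S|lborel. - \<phi> y) = - (LINT y:S|lborel. \<phi> y)" for S
    by (simp add: set_lebesgue_integral_def)
  then show ?thesis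
    by (simp add: mean_op_def Let_def INF_eq_uminus_SUP algebra_simps diff_divide_distrib)
qed

text \<open>The infimum of a set of reals is by definition the negated supremum of the negated set, so the
duality holds for unbounded \<open>\<phi>\<close> too.\<close>

lemma A_minus_eq: "A_minus p m M \<epsilon> \<phi> x = - A_plus p m M \<epsilon> (\<lambda>y. - \<phi> y) x"
proof -
  have "- A_plus p m M \<epsilon> (\<lambda>y. - \<phi> y) x = (SUP c\<in>{m \<epsilon>..M \<epsilon>}.
      - (alpha_const p * (SUP y\<in>ball x (\<epsilon>\<^sup>2 * c powr (1 - alpha_const p)). - \<phi> y)
       + (1 - alpha_const p) * mean_op p (\<epsilon> * c powr (- alpha_const p / 2)) (\<lambda>y. - \<phi> y) x))"
    unfolding A_plus_def Let_def by (subst INF_eq_uminus_SUP) simp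
  also have "\<dots> = A_minus p m M \<epsilon> \<phi> x"
    unfolding A_minus_def Let_def mean_op_uminus
    by (intro SUP_cong refl) (simp add: INF_eq_uminus_SUP algebra_simps)
  finally show ?thesis by simp
qed

lemma A_minus_consistent:
  fixes \<phi> :: "'a::euclidean_space \<Rightarrow> real"
  assumes p: "p > 2" and mM: "scale_range (alpha_const p) m M"
    and C: "C2_at \<phi> x R X" and k: "k \<le> 0" and nz: "k = 0 \<Longrightarrow> p_laplacian p \<phi> x \<noteq> 0"
  shows "le_o_sq (\<lambda>\<epsilon>. A_minus p m M \<epsilon> \<phi> x - \<phi> x) (\<lambda>\<epsilon>. \<epsilon>\<^sup>2 * signed_power p k) \<longleftrightarrow> p_laplacian p \<phi> x \<le> k"
    and "ge_o_sq (\<lambda>\<epsilon>. A_minus p m M \<epsilon> \<phi> x - \<phi> x) (\<lambda>\<epsilon>. \<epsilon>\<^sup>2 * signed_power p k) \<longleftrightarrow> k \<le> p_laplacian p \<phi> x"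
proof -
  let ?a = "\<lambda>\<epsilon>. A_plus p m M \<epsilon> (\<lambda>y. - \<phi> y) x - - \<phi> x"
  have "- k \<ge> 0" "- k = 0 \<Longrightarrow> p_laplacian p (\<lambda>y. - \<phi> y) x \<noteq> 0"
    using k nz p_laplacian_uminus[OF p C] by auto
  note * = A_plus_consistent[OF p mM C2_at_uminus(1)[OF C] this,
      unfolded p_laplacian_uminus[OF p C] signed_power_uminus[OF p] neg_le_iff_le]
  have eq: "(\<lambda>\<epsilon>. A_minus p m M \<epsilon> \<phi> x - \<phi> x) = (\<lambda>\<epsilon>. - ?a \<epsilon>)"
    by (simp add: A_minus_eq)
  have "le_o_sq (\<lambda>\<epsilon>. - ?a \<epsilon>) (\<lambda>\<epsilon>. \<epsilon>\<^sup>2 * signed_power p k) \<longleftrightarrow> ge_o_sq ?a (\<lambda>\<epsilon>. \<epsilon>\<^sup>2 * - signed_power p k)"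
    unfolding ge_o_sq_iff_le_o_sq minus_minus ..
  then show "le_o_sq (\<lambda>\<epsilon>. A_minus p m M \<epsilon> \<phi> x - \<phi> x) (\<lambda>\<epsilon>. \<epsilon>\<^sup>2 * signed_power p k) \<longleftrightarrow> p_laplacian p \<phi> x \<le> k"
    unfolding eq using *(2) by simp
  have "ge_o_sq (\<lambda>\<epsilon>. - ?a \<epsilon>) (\<lambda>\<epsilon>. \<epsilon>\<^sup>2 * signed_power p k) \<longleftrightarrow> le_o_sq ?a (\<lambda>\<epsilon>. \<epsilon>\<^sup>2 * - signed_power p k)"
    unfolding ge_o_sq_iff_le_o_sq minus_minus ..
  then show "ge_o_sq (\<lambda>\<epsilon>. A_minus p m M \<epsilon> \<phi> x - \<phi> x) (\<lambda>\<epsilon>. \<epsilon>\<^sup>2 * signed_power p k) \<longleftrightarrow> k \<le> p_laplacian p \<phi> x"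
    unfolding eq using *(1) by simp
qed

text \<open>The two choices of \<open>A\<close> differ only where \<open>f x = 0\<close>, and there both \<open>A_plus\<close> and \<open>A_minus\<close> are
consistent.\<close>

lemma mean_value_consistency:
  fixes \<phi> f :: "'a::euclidean_space \<Rightarrow> real"
  assumes p: "p > 2" and mM: "scale_range (alpha_const p) m M"
    and A: "A = A_over p m M \<or> A = A_under p m M"
    and C: "C2_at \<phi> x R X" and nz: "f x = 0 \<Longrightarrow> p_laplacian p \<phi> x \<noteq> 0"
  shows "le_o_sq (\<lambda>\<epsilon>. A \<epsilon> \<phi> f x - \<phi> x) (\<lambda>\<epsilon>. \<epsilon>\<^sup>2 * signed_power p (f x)) \<longleftrightarrow> p_laplacian p \<phi> x \<le> f x"
    and "ge_o_sq (\<lambda>\<epsilon>. A \<epsilon> \<phi> f x - \<phi> x) (\<lambda>\<epsilon>. \<epsilon>\<^sup>2 * signed_power p (f x)) \<longleftrightarrow> f x \<le> p_laplacian p \<phi> x"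
proof -
  consider "f x \<ge> 0" "\<And>\<epsilon>. A \<epsilon> \<phi> f x = A_plus p m M \<epsilon> \<phi> x"
    | "f x \<le> 0" "\<And>\<epsilon>. A \<epsilon> \<phi> f x = A_minus p m M \<epsilon> \<phi> x"
    using A by (cases "f x" "0::real" rule: linorder_cases) (auto simp: A_over_def A_under_def)
  then show "le_o_sq (\<lambda>\<epsilon>. A \<epsilon> \<phi> f x - \<phi> x) (\<lambda>\<epsilon>. \<epsilon>\<^sup>2 * signed_power p (f x)) \<longleftrightarrow> p_laplacian p \<phi> x \<le> f x"
    and "ge_o_sq (\<lambda>\<epsilon>. A \<epsilon> \<phi> f x - \<phi> x) (\<lambda>\<epsilon>. \<epsilon>\<^sup>2 * signed_power p (f x)) \<longleftrightarrow> f x \<le> p_laplacian p \<phi> x"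
    using A_plus_consistent[OF p mM C _ nz] A_minus_consistent[OF p mM C _ nz]
    by (cases; simp)+
qed

section \<open>Equivalence of the viscosity notions\<close>

lemma Cinf_on_Ck_on: "Cinf_on \<phi> S \<Longrightarrow> Ck_on k \<phi> S"
  by (simp add: Cinf_on_def)

text \<open>A \<open>C\<^sup>2\<close> test function violating the differential inequality can be replaced by a smooth one that
touches from the same side and violates it as well. The sign \<open>s = 1\<close> is for touching from above,
\<open>s = -1\<close> for touching from below.\<close>

lemma smooth_test_perturbation:
  fixes \<phi> :: "'a::euclidean_space \<Rightarrow> real"
  assumes p: "p > 2" and Ck: "Ck_on 2 \<phi> (ball x R)" and R: "R > 0"
    and s: "s = 1 \<or> s = - 1" and gap: "s * (p_laplacian p \<phi> x - k) < 0"
  obtains P r where "0 < r" "r \<le> R" "Cinf_on P (ball x r)" "P x = \<phi> x" "grad P x = grad \<phi> x"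
    "\<And>y. y \<in> ball x r \<Longrightarrow> s * (P y - \<phi> y) \<ge> 0" "s * (p_laplacian p P x - k) < 0"
proof -
  obtain X where C: "C2_at \<phi> x R X" using Ck_2_C2_at[OF Ck R] .
  define w where "w = (if grad \<phi> x = 0 then 0 else norm (grad \<phi> x) powr (p - 2) * (real DIM('a) + p - 2))"
  have w: "w \<ge> 0" using p by (simp add: w_def)
  \<comment> \<open>The tilt \<open>s * t\<close> moves the p-Laplacian by \<open>s * t * w\<close>; this \<open>t\<close> keeps that below half of the
    gap, and \<open>w + 1\<close> avoids dividing by \<open>0\<close> when the gradient vanishes.\<close>
  define t where "t = - s * (p_laplacian p \<phi> x - k) / (2 * (w + 1))"
  have t: "t > 0" unfolding t_def using gap w by (intro divide_pos_pos) auto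
  have "t * w < - s * (p_laplacian p \<phi> x - k)"
  proof -
    have "t * (2 * (w + 1)) = - s * (p_laplacian p \<phi> x - k)" using w by (simp add: t_def)
    moreover have "t * w < t * (2 * (w + 1))" using t w by (intro mult_strict_left_mono) auto
    ultimately show ?thesis by simp
  qed
  then have gap': "s * (p_laplacian p \<phi> x + s * t * w - k) < 0"
    using s by (auto simp: algebra_simps)
  have st: "s * t \<noteq> 0" using s t by auto
  obtain P r where P: "r > 0" "\<And>S. Cinf_on P S" "P x = \<phi> x"
    "grad P x = grad \<phi> x" "\<And>y. y \<in> ball x r \<Longrightarrow> s * t * (P y - \<phi> y) \<ge> 0"
    "p_laplacian p P x = p_laplacian p \<phi> x +
       (if grad \<phi> x = 0 then 0 else s * t * (norm (grad \<phi> x) powr (p - 2) * (real DIM('a) + p - 2)))"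
    using quadratic_comparison[OF p C st] by metis
  show ?thesis
  proof (rule that[of "min r R" P])
    show "s * (P y - \<phi> y) \<ge> 0" if "y \<in> ball x (min r R)" for y
      using P(5)[of y] that t by (simp add: mult.commute[of s t] mult.assoc zero_le_mult_iff)
    show "s * (p_laplacian p P x - k) < 0" using gap' unfolding P(6) w_def by (simp split: if_splits)
  qed (use P R in auto)
qed

text \<open>From the equation to the mean value property, consistency applies directly to the smooth test.
Conversely, a violating \<open>C\<^sup>2\<close> test yields a violating smooth one, whose p-Laplacian exceeds \<open>f x\<close>
strictly; at a zero of \<open>f\<close> it is therefore nonzero, so that the test is admissible.\<close>

lemma supersolution_tests_iff:
  fixes f u :: "'a::euclidean_space \<Rightarrow> real"
  assumes p: "p > 2" and mM: "scale_range (alpha_const p) m M"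
    and A: "A = A_over p m M \<or> A = A_under p m M"
  shows "(\<forall>R>0. \<forall>\<phi>. Ck_on 2 \<phi> (ball x R) \<and> touches_from_below \<Omega> R \<phi> u x \<and>
        (f x = 0 \<longrightarrow> grad \<phi> x \<noteq> 0) \<longrightarrow> p_laplacian p \<phi> x \<le> f x) \<longleftrightarrow>
     (\<forall>R>0. \<forall>\<phi>. Cinf_on \<phi> (ball x R) \<and> touches_from_below \<Omega> R \<phi> u x \<and>
        (f x = 0 \<longrightarrow> grad \<phi> x \<noteq> 0 \<and> p_laplacian p \<phi> x \<noteq> 0) \<longrightarrow>
        le_o_sq (\<lambda>\<epsilon>. A \<epsilon> \<phi> f x - \<phi> x) (\<lambda>\<epsilon>. \<epsilon>^2 * signed_power p (f x)))"
  (is "?pde \<longleftrightarrow> ?amvp")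
proof (intro iffI allI impI; (elim conjE)?)
  fix R :: real and \<phi> :: "'a \<Rightarrow> real"
  assume pde: ?pde and R: "R > 0" and \<phi>: "Cinf_on \<phi> (ball x R)" "touches_from_below \<Omega> R \<phi> u x"
    "f x = 0 \<longrightarrow> grad \<phi> x \<noteq> 0 \<and> p_laplacian p \<phi> x \<noteq> 0"
  obtain X where C: "C2_at \<phi> x R X" using Ck_2_C2_at[OF Cinf_on_Ck_on[OF \<phi>(1)] R] .
  have "p_laplacian p \<phi> x \<le> f x" using pde R \<phi> Cinf_on_Ck_on by blast
  then show "le_o_sq (\<lambda>\<epsilon>. A \<epsilon> \<phi> f x - \<phi> x) (\<lambda>\<epsilon>. \<epsilon>^2 * signed_power p (f x))"
    using mean_value_consistency(1)[where f = f, OF p mM A C] \<phi>(3) by blast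
next
  fix R :: real and \<phi> :: "'a \<Rightarrow> real"
  assume amvp: ?amvp and R: "R > 0" and \<phi>: "Ck_on 2 \<phi> (ball x R)" "touches_from_below \<Omega> R \<phi> u x"
    "f x = 0 \<longrightarrow> grad \<phi> x \<noteq> 0"
  show "p_laplacian p \<phi> x \<le> f x"
  proof (rule ccontr)
    assume "\<not> p_laplacian p \<phi> x \<le> f x"
    then have "- 1 * (p_laplacian p \<phi> x - f x) < 0" by simp
    then obtain P r where P: "0 < r" "r \<le> R" "Cinf_on P (ball x r)" "P x = \<phi> x" "grad P x = grad \<phi> x"
      "\<And>y. y \<in> ball x r \<Longrightarrow> - 1 * (P y - \<phi> y) \<ge> 0" "- 1 * (p_laplacian p P x - f x) < 0"
      using smooth_test_perturbation[OF p \<phi>(1) R, of "- 1" "f x"] by blast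
    obtain X where C: "C2_at P x r X" using Ck_2_C2_at[OF Cinf_on_Ck_on[OF P(3)] P(1)] .
    have "touches_from_below \<Omega> r P u x"
      unfolding touches_from_below_def
    proof
      fix y assume y: "y \<in> (ball x r - {x}) \<inter> \<Omega>"
      then have "\<phi> y - u y \<le> \<phi> x - u x" using \<phi>(2) P(2) by (auto simp: touches_from_below_def)
      then show "P y - u y \<le> P x - u x" using P(4) P(6)[of y] y by auto
    qed
    moreover have nz: "f x = 0 \<longrightarrow> grad P x \<noteq> 0 \<and> p_laplacian p P x \<noteq> 0"
      using \<phi>(3) P(5,7) by auto
    ultimately have "le_o_sq (\<lambda>\<epsilon>. A \<epsilon> P f x - P x) (\<lambda>\<epsilon>. \<epsilon>^2 * signed_power p (f x))"
      using amvp P(1,3) by blast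
    then show False
      using mean_value_consistency(1)[where f = f, OF p mM A C] nz P(7) by auto
  qed
qed

lemma subsolution_tests_iff:
  fixes f u :: "'a::euclidean_space \<Rightarrow> real"
  assumes p: "p > 2" and mM: "scale_range (alpha_const p) m M"
    and A: "A = A_over p m M \<or> A = A_under p m M"
  shows "(\<forall>R>0. \<forall>\<phi>. Ck_on 2 \<phi> (ball x R) \<and> touches_from_above \<Omega> R \<phi> u x \<and>
        (f x = 0 \<longrightarrow> grad \<phi> x \<noteq> 0) \<longrightarrow> p_laplacian p \<phi> x \<ge> f x) \<longleftrightarrow>
     (\<forall>R>0. \<forall>\<phi>. Cinf_on \<phi> (ball x R) \<and> touches_from_above \<Omega> R \<phi> u x \<and>
        (f x = 0 \<longrightarrow> grad \<phi> x \<noteq> 0 \<and> p_laplacian p \<phi> x \<noteq> 0) \<longrightarrow>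
        ge_o_sq (\<lambda>\<epsilon>. A \<epsilon> \<phi> f x - \<phi> x) (\<lambda>\<epsilon>. \<epsilon>^2 * signed_power p (f x)))"
  (is "?pde \<longleftrightarrow> ?amvp")
proof (intro iffI allI impI; (elim conjE)?)
  fix R :: real and \<phi> :: "'a \<Rightarrow> real"
  assume pde: ?pde and R: "R > 0" and \<phi>: "Cinf_on \<phi> (ball x R)" "touches_from_above \<Omega> R \<phi> u x"
    "f x = 0 \<longrightarrow> grad \<phi> x \<noteq> 0 \<and> p_laplacian p \<phi> x \<noteq> 0"
  obtain X where C: "C2_at \<phi> x R X" using Ck_2_C2_at[OF Cinf_on_Ck_on[OF \<phi>(1)] R] .
  have "p_laplacian p \<phi> x \<ge> f x" using pde R \<phi> Cinf_on_Ck_on by blast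
  then show "ge_o_sq (\<lambda>\<epsilon>. A \<epsilon> \<phi> f x - \<phi> x) (\<lambda>\<epsilon>. \<epsilon>^2 * signed_power p (f x))"
    using mean_value_consistency(2)[where f = f, OF p mM A C] \<phi>(3) by blast
next
  fix R :: real and \<phi> :: "'a \<Rightarrow> real"
  assume amvp: ?amvp and R: "R > 0" and \<phi>: "Ck_on 2 \<phi> (ball x R)" "touches_from_above \<Omega> R \<phi> u x"
    "f x = 0 \<longrightarrow> grad \<phi> x \<noteq> 0"
  show "p_laplacian p \<phi> x \<ge> f x"
  proof (rule ccontr)
    assume "\<not> p_laplacian p \<phi> x \<ge> f x"
    then have "1 * (p_laplacian p \<phi> x - f x) < 0" by simp
    then obtain P r where P: "0 < r" "r \<le> R" "Cinf_on P (ball x r)" "P x = \<phi> x" "grad P x = grad \<phi> x"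
      "\<And>y. y \<in> ball x r \<Longrightarrow> 1 * (P y - \<phi> y) \<ge> 0" "1 * (p_laplacian p P x - f x) < 0"
      using smooth_test_perturbation[OF p \<phi>(1) R, of 1 "f x"] by blast
    obtain X where C: "C2_at P x r X" using Ck_2_C2_at[OF Cinf_on_Ck_on[OF P(3)] P(1)] .
    have "touches_from_above \<Omega> r P u x"
      unfolding touches_from_above_def
    proof
      fix y assume y: "y \<in> (ball x r - {x}) \<inter> \<Omega>"
      then have "\<phi> x - u x \<le> \<phi> y - u y" using \<phi>(2) P(2) by (auto simp: touches_from_above_def)
      then show "P x - u x \<le> P y - u y" using P(4) P(6)[of y] y by auto
    qed
    moreover have nz: "f x = 0 \<longrightarrow> grad P x \<noteq> 0 \<and> p_laplacian p P x \<noteq> 0"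
      using \<phi>(3) P(5,7) by auto
    ultimately have "ge_o_sq (\<lambda>\<epsilon>. A \<epsilon> P f x - P x) (\<lambda>\<epsilon>. \<epsilon>^2 * signed_power p (f x))"
      using amvp P(1,3) by blast
    then show False
      using mean_value_consistency(2)[where f = f, OF p mM A C] nz P(7) by auto
  qed
qed

theorem corollary2p4:
  fixes p :: real
    and \<Omega> :: "'a::euclidean_space set"
    and f u :: "'a \<Rightarrow> real"
    and m M :: "real \<Rightarrow> real"
    and A :: "real \<Rightarrow> ('a \<Rightarrow> real) \<Rightarrow> ('a \<Rightarrow> real) \<Rightarrow> 'a \<Rightarrow> real"
  assumes "p > 2"
    and "open \<Omega>"
    and "continuous_on \<Omega> f"
    and "\<And>\<epsilon>. \<epsilon> > 0 \<Longrightarrow> m \<epsilon> = \<epsilon> powr (2 / (2 + alpha_const p))"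
    and "\<And>\<epsilon>. \<epsilon> > 0 \<Longrightarrow> M \<epsilon> = \<epsilon> powr (- 2 / (2 - alpha_const p))"
    and "A = A_over p m M \<or> A = A_under p m M"
  shows "pde_solution p \<Omega> f u \<longleftrightarrow> amvp_solution p A \<Omega> f u"
proof -
  have mM: "scale_range (alpha_const p) m M"
    using assms(4,5) by (simp add: scale_range_def)
  have "pde_supersolution p \<Omega> f u \<longleftrightarrow> amvp_supersolution p A \<Omega> f u"
    unfolding pde_supersolution_def amvp_supersolution_def
      supersolution_tests_iff[OF assms(1) mM assms(6)] ..
  moreover have "pde_subsolution p \<Omega> f u \<longleftrightarrow> amvp_subsolution p A \<Omega> f u"
    unfolding pde_subsolution_def amvp_subsolution_def
      subsolution_tests_iff[OF assms(1) mM assms(6)] ..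
  ultimately show ?thesis
    unfolding pde_solution_def amvp_solution_def
    by (auto simp: pde_supersolution_def)
qed

end
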